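(* Let $\gamma:\Gamma\to\Delta$ be a forwards immersion of graphs. There is a unique graph map $s_\Gamma:\mathbb{S}_\Gamma\to\Gamma$, where $\mathbb{S}_\Gamma$ is a disjoint union of at most $\beta_1(\Gamma)$ circles, such that, if $f:S^1\to\Gamma$ is a cycle satisfying $$\frac{\deg(\gamma\circ f)}{\deg(f)}\ \ge\ 12\cdot\beta_1(\Gamma),$$ then $f$ factors through $s_\Gamma$.
   Context: A graph is a directed graph $\Gamma=(V,E,o,t)$ with origin and target maps $o,t:E\to V$ (loops and multiple edges allowed). A graph map is a pair of maps on vertices and edges commuting with $o$ and $t$. It is a forwards immersion if, at every vertex $v$, it is injective on the set of edges with origin $v$. $\beta_1(\Gamma)$ is the first Betti number of the underlying topological graph. A circle is a graph with vertices $v_0,\dots,v_{k-1}$ and edges $e_0,\dots,e_{k-1}$ ($k\ge1$), $o(e_i)=v_i$, $t(e_i)=v_{i+1}$, indices mod $k$. A cycle in $\Gamma$ is a graph map $f:S^1\to\Gamma$ from a circle. The degree $\deg(f)$ of a cycle $f$ is the largest degree of a covering map $S^1\to S^1$ through which $f$ factors. A cycle $f:S^1\to\Gamma$ factors through $s_\Gamma$ if $f=s_\Gamma\circ h$ for some graph map $h:S^1\to\mathbb{S}_\Gamma$.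
   Formalization: Uniqueness is proved, up to isomorphism over Γ, for the minimal such map (no circle can be omitted), because the literal uniqueness fails: for Γ=Δ a single loop and γ the identity, both the empty union and any circle have the property. *)

theory Defs
  imports
    "HOL-Library.Extended_Real"
    "HOL-Library.Function_Algebras"
    "Graph_Theory.Digraph"
begin

text \<open>
  A graph is a \<^const>\<open>wf_digraph\<close> of any cardinality, possibly empty; the maps o and t are
  \<^const>\<open>tail\<close> and \<^const>\<open>head\<close>. A graph map is a pair (action on vertices, action on edges);
  only its values on the vertices and edges of the source graph are meaningful.
\<close>

type_synonym ('v, 'e, 'w, 'f) gmap = "('v \<Rightarrow> 'w) \<times> ('e \<Rightarrow> 'f)"

definition graph_map ::
  "('v, 'e) pre_digraph \<Rightarrow> ('w, 'f) pre_digraph \<Rightarrow> ('v, 'e, 'w, 'f) gmap \<Rightarrow> bool" where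
  "graph_map G H f \<longleftrightarrow>
     (\<forall>v \<in> verts G. fst f v \<in> verts H) \<and>
     (\<forall>e \<in> arcs G. snd f e \<in> arcs H
        \<and> tail H (snd f e) = fst f (tail G e)
        \<and> head H (snd f e) = fst f (head G e))"

definition gmap_eq ::
  "('v, 'e) pre_digraph \<Rightarrow> ('v, 'e, 'w, 'f) gmap \<Rightarrow> ('v, 'e, 'w, 'f) gmap \<Rightarrow> bool" where
  "gmap_eq G f g \<longleftrightarrow>
     (\<forall>v \<in> verts G. fst f v = fst g v) \<and> (\<forall>e \<in> arcs G. snd f e = snd g e)"

definition gmap_comp ::
  "('w, 'f, 'x, 'h) gmap \<Rightarrow> ('v, 'e, 'w, 'f) gmap \<Rightarrow> ('v, 'e, 'x, 'h) gmap"
  (infixl \<open>\<circ>\<^sub>g\<close> 55) where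
  "g \<circ>\<^sub>g f = (fst g \<circ> fst f, snd g \<circ> snd f)"

definition graph_iso ::
  "('v, 'e) pre_digraph \<Rightarrow> ('w, 'f) pre_digraph \<Rightarrow> ('v, 'e, 'w, 'f) gmap \<Rightarrow> bool" where
  "graph_iso G H f \<longleftrightarrow>
     graph_map G H f \<and> bij_betw (fst f) (verts G) (verts H) \<and> bij_betw (snd f) (arcs G) (arcs H)"

definition forwards_immersion ::
  "('v, 'e) pre_digraph \<Rightarrow> ('w, 'f) pre_digraph \<Rightarrow> ('v, 'e, 'w, 'f) gmap \<Rightarrow> bool" where
  "forwards_immersion G H f \<longleftrightarrow>
     graph_map G H f \<and> (\<forall>v \<in> verts G. inj_on (snd f) (out_arcs G v))"


text \<open>
  A graph is a one-dimensional CW complex, so its first homology with rational coefficients is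
  the kernel of the cellular boundary map on finitely supported 1-chains (there are no 2-cells).
  The first Betti number is the dimension of this space, with value \<open>\<infinity>\<close> if it is not
  finite-dimensional.
\<close>

global_interpretation chain: vector_space "\<lambda>(c::rat) (x::'e \<Rightarrow> rat) e. c * x e"
  by unfold_locales (auto simp: fun_eq_iff algebra_simps)

definition boundary :: "('v, 'e) pre_digraph \<Rightarrow> ('e \<Rightarrow> rat) \<Rightarrow> 'v \<Rightarrow> rat" where
  "boundary G x v =
     (\<Sum>e | x e \<noteq> 0 \<and> head G e = v. x e) - (\<Sum>e | x e \<noteq> 0 \<and> tail G e = v. x e)"

definition H1 :: "('v, 'e) pre_digraph \<Rightarrow> ('e \<Rightarrow> rat) set" where
  "H1 G = {x. finite {e. x e \<noteq> 0} \<and> {e. x e \<noteq> 0} \<subseteq> arcs G \<and> (\<forall>v \<in> verts G. boundary G x v = 0)}"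

definition betti1 :: "('v, 'e) pre_digraph \<Rightarrow> enat" where
  "betti1 G = (SUP B \<in> {B. finite B \<and> B \<subseteq> H1 G \<and> chain.independent B}. enat (card B))"


definition circle :: "nat \<Rightarrow> (nat, nat) pre_digraph" where
  "circle k = \<lparr>verts = {..<k}, arcs = {..<k}, tail = (\<lambda>i. i), head = (\<lambda>i. Suc i mod k)\<rparr>"

definition cycle :: "('v, 'e) pre_digraph \<Rightarrow> nat \<Rightarrow> (nat, nat, 'v, 'e) gmap \<Rightarrow> bool" where
  "cycle G k f \<longleftrightarrow> k \<ge> 1 \<and> graph_map (circle k) G f"

definition covering_map_of_degree ::
  "('v, 'e) pre_digraph \<Rightarrow> ('w, 'f) pre_digraph \<Rightarrow> ('v, 'e, 'w, 'f) gmap \<Rightarrow> nat \<Rightarrow> bool" where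
  "covering_map_of_degree G H p d \<longleftrightarrow>
     graph_map G H p \<and> fst p ` verts G = verts H \<and>
     (\<forall>v \<in> verts G. bij_betw (snd p) (out_arcs G v) (out_arcs H (fst p v)) \<and>
                     bij_betw (snd p) (in_arcs G v) (in_arcs H (fst p v))) \<and>
     (\<forall>w \<in> verts H. card {v \<in> verts G. fst p v = w} = d)"

text \<open>The set below is nonempty (\<open>d = 1\<close>) and bounded by \<open>k\<close> whenever \<open>cycle G k f\<close> holds.\<close>

definition cycle_degree :: "('v, 'e) pre_digraph \<Rightarrow> nat \<Rightarrow> (nat, nat, 'v, 'e) gmap \<Rightarrow> nat" where
  "cycle_degree G k f =
     Max {d. \<exists>m p g. m \<ge> 1 \<and> covering_map_of_degree (circle k) (circle m) p d \<and>
                     graph_map (circle m) G g \<and> gmap_eq (circle k) f (g \<circ>\<^sub>g p)}"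


text \<open>The disjoint union, over \<open>i \<in> I\<close>, of circles with \<open>l i\<close> edges.\<close>

definition circles :: "'i set \<Rightarrow> ('i \<Rightarrow> nat) \<Rightarrow> ('i \<times> nat, 'i \<times> nat) pre_digraph" where
  "circles I l =
     \<lparr>verts = (SIGMA i:I. verts (circle (l i))), arcs = (SIGMA i:I. arcs (circle (l i))),
      tail = (\<lambda>(i, e). (i, tail (circle (l i)) e)), head = (\<lambda>(i, e). (i, head (circle (l i)) e))\<rparr>"

definition factors_through ::
  "nat \<Rightarrow> (nat, nat, 'v, 'e) gmap \<Rightarrow> ('w, 'f) pre_digraph \<Rightarrow> ('w, 'f, 'v, 'e) gmap \<Rightarrow> bool" where
  "factors_through k f S s \<longleftrightarrow>
     (\<exists>h. graph_map (circle k) S h \<and> gmap_eq (circle k) f (s \<circ>\<^sub>g h))"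

definition captures_long_cycles ::
  "('v, 'e) pre_digraph \<Rightarrow> ('w, 'f) pre_digraph \<Rightarrow> ('v, 'e, 'w, 'f) gmap \<Rightarrow>
   'i set \<Rightarrow> ('i \<Rightarrow> nat) \<Rightarrow> ('i \<times> nat, 'i \<times> nat, 'v, 'e) gmap \<Rightarrow> bool" where
  "captures_long_cycles \<Gamma> \<Delta> \<gamma> I l s \<longleftrightarrow>
     (\<forall>i \<in> I. l i \<ge> 1) \<and>
     (if finite I then enat (card I) else \<infinity>) \<le> betti1 \<Gamma> \<and>
     graph_map (circles I l) \<Gamma> s \<and>
     (\<forall>k f. cycle \<Gamma> k f \<longrightarrow>
        ereal (real (cycle_degree \<Delta> k (\<gamma> \<circ>\<^sub>g f)) / real (cycle_degree \<Gamma> k f))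
          \<ge> 12 * ereal_of_enat (betti1 \<Gamma>) \<longrightarrow>
        factors_through k f (circles I l) s)"

text \<open>
  Adding superfluous circles, when the bound on their number leaves room, preserves
  \<^const>\<open>captures_long_cycles\<close>. Uniqueness therefore refers to the maps from which no circle can
  be omitted.
\<close>

definition minimally_captures_long_cycles ::
  "('v, 'e) pre_digraph \<Rightarrow> ('w, 'f) pre_digraph \<Rightarrow> ('v, 'e, 'w, 'f) gmap \<Rightarrow>
   'i set \<Rightarrow> ('i \<Rightarrow> nat) \<Rightarrow> ('i \<times> nat, 'i \<times> nat, 'v, 'e) gmap \<Rightarrow> bool" where
  "minimally_captures_long_cycles \<Gamma> \<Delta> \<gamma> I l s \<longleftrightarrow>
     captures_long_cycles \<Gamma> \<Delta> \<gamma> I l s \<and> (\<forall>J. J \<subset> I \<longrightarrow> \<not> captures_long_cycles \<Gamma> \<Delta> \<gamma> J l s)"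

end

theory Submission
  imports Defs
begin

text \<open>
  Unrolling a cycle gives a periodic sequence of edges of \<open>\<Gamma>\<close>, and the quotient of degrees in the
  hypothesis is \<open>n = k / m\<close>, where \<open>k\<close> is the least period of this sequence and \<open>m\<close> that of its
  image in \<open>\<Delta>\<close>. So a family of circles captures the long cycles iff each long primitive
  cycle is, up to rotation, one of them, and it suffices to bound the number of classes of these
  by \<open>\<beta>\<close>.

  Let \<open>F\<close> be a finite nonempty set of inequivalent long primitive cycles, and let \<open>E\<close> be the set of
  edges they traverse. Since \<open>|E| - |V| \<le> \<beta>\<close>, at most \<open>2\<beta>\<close> edges of \<open>E\<close> share their head with
  another one. Let \<open>c \<in> F\<close> have the largest label period \<open>m\<close>, and order its positions
  lexicographically by their futures in \<open>\<Delta>\<close>. In a forwards immersion this order is compatible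
  with moving forwards along an edge (it is a stacking in the sense of Louder and Wilton), and the
  positions of largest future occur \<open>n\<close> times. As \<open>n\<close> is large compared with the number of edges
  where a position can stop being the highest one over its vertex, some stretch of \<open>c\<close> of length \<open>2m\<close>
  consists of edges that are the only ones entering their head. A cycle in \<open>F\<close> that traverses the
  last edge of the stretch traverses all of it, hence equals \<open>c\<close> by the argument of Fine and Wilf.
  So every such \<open>F\<close> contains a cycle with an edge of its own, and the homology classes of
  inequivalent long primitive cycles are linearly independent.
\<close>

subsection \<open>Periodic sequences\<close>

lemma mod_add_lcancel_nat:
  fixes a u v k :: nat
  assumes "(a + u) mod k = (a + v) mod k"
  shows "u mod k = v mod k"
proof -
  have "int (a + u) mod int k = int (a + v) mod int k"
    using assms by (simp only: zmod_int[symmetric])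
  then have "(int (a + u) - int a) mod int k = (int (a + v) - int a) mod int k"
    by (rule mod_diff_cong) simp
  then show ?thesis by (simp flip: zmod_int)
qed

definition is_period :: "(nat \<Rightarrow> 'a) \<Rightarrow> nat \<Rightarrow> bool" where
  "is_period c p \<longleftrightarrow> (\<forall>x. c (x + p) = c x)"

definition periodic :: "(nat \<Rightarrow> 'a) \<Rightarrow> bool" where
  "periodic c \<longleftrightarrow> (\<exists>p\<ge>1. is_period c p)"

text \<open>Meaningful only for periodic sequences. The bound \<open>p \<ge> 1\<close> excludes 0,
  which always satisfies \<open>is_period\<close>.\<close>

definition per :: "(nat \<Rightarrow> 'a) \<Rightarrow> nat" where
  "per c = (LEAST p. p \<ge> 1 \<and> is_period c p)"

lemma per_period: "periodic c \<Longrightarrow> is_period c (per c)"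
  and per_ge_1: "periodic c \<Longrightarrow> per c \<ge> 1"
  using LeastI_ex[of "\<lambda>p. p \<ge> 1 \<and> is_period c p"] by (auto simp: periodic_def per_def)

lemma is_period_mult: "is_period c p \<Longrightarrow> is_period c (p * q)"
  unfolding is_period_def
  by (induction q) (simp_all add: algebra_simps, metis add.assoc)

lemma is_period_mod: "is_period c p \<Longrightarrow> c (x mod p) = c x"
  using is_period_mult[of c p "x div p"] unfolding is_period_def
  by (metis mod_mult_div_eq)

lemma is_period_cong: "is_period c p \<Longrightarrow> x mod p = y mod p \<Longrightarrow> c x = c y"
  using is_period_mod[of c p x] is_period_mod[of c p y] by simp

lemma is_period_add: "is_period c p \<Longrightarrow> c (x + p) = c x"
  by (simp add: is_period_def)

lemma is_period_comp: "is_period c p \<Longrightarrow> is_period (g \<circ> c) p"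
  by (simp add: is_period_def)

lemma periodic_comp: "periodic c \<Longrightarrow> periodic (g \<circ> c)"
  by (auto simp: periodic_def intro: is_period_comp)

lemma range_periodic: "periodic c \<Longrightarrow> range c = c ` {..<per c}"
proof (intro equalityI image_subsetI)
  fix x assume c: "periodic c"
  show "c x \<in> c ` {..<per c}"
    using is_period_mod[OF per_period[OF c], of x] per_ge_1[OF c]
    by (intro image_eqI[of _ _ "x mod per c"]) auto
qed auto

lemma finite_range_periodic: "periodic c \<Longrightarrow> finite (range c)"
  by (simp add: range_periodic)

text \<open>The remainder of \<open>p\<close> modulo the least period is again a period. It is
  smaller than the least one, so it must be 0.\<close>

lemma per_dvd:
  assumes "is_period c p" "p \<ge> 1"
  shows "per c dvd p"
proof -
  have c: "periodic c" using assms by (auto simp: periodic_def)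
  have "c (x + p mod per c) = c x" for x
  proof -
    have "c (x + p mod per c) = c (x + p)"
      by (rule is_period_cong[OF per_period[OF c]]) (simp add: mod_add_right_eq)
    then show ?thesis using assms by (simp add: is_period_def)
  qed
  then have "is_period c (p mod per c)" by (simp add: is_period_def)
  moreover have "p mod per c < per c" using per_ge_1[OF c] by simp
  ultimately have "p mod per c = 0"
    using not_less_Least[of "p mod per c" "\<lambda>p. p \<ge> 1 \<and> is_period c p"] by (auto simp: per_def)
  then show ?thesis by auto
qed

text \<open>Positions are natural numbers, so a shift by \<open>j\<close> cannot be undone by
  subtraction. Going forwards to the next suitable multiple of the period undoes it instead.\<close>

lemma periodic_unshift:
  assumes "periodic c"
  obtains i where "\<And>x. c (x + i + j) = c x"
proof -
  have "j \<le> per c * j" using per_ge_1[OF assms] by simp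
  then obtain i where i: "per c * j = i + j" by (metis le_add_diff_inverse2)
  have "is_period c (per c * j)" by (intro is_period_mult per_period assms)
  then show ?thesis using that[of i] by (simp add: is_period_def i add.assoc)
qed

lemma is_period_of_shift:
  assumes "periodic c" "is_period (\<lambda>x. c (x + j)) p"
  shows "is_period c p"
proof -
  obtain i where i: "\<And>x. c (x + i + j) = c x" using periodic_unshift[OF assms(1)] by metis
  have "c (x + p) = c x" for x
  proof -
    have "c ((x + i) + p + j) = c ((x + i) + j)"
      using assms(2) by (simp add: is_period_def)
    then show ?thesis using i[of x] i[of "x + p"] by (simp add: add_ac)
  qed
  then show ?thesis by (simp add: is_period_def)
qed

lemma is_period_shift: "is_period c p \<Longrightarrow> is_period (\<lambda>x. c (x + j)) p"
  by (simp add: is_period_def) (metis add.commute add.left_commute)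

lemma per_shift: "periodic c \<Longrightarrow> per (\<lambda>x. c (x + j)) = per c"
  using is_period_of_shift[of c j] is_period_shift[of c _ j] unfolding per_def
  by (intro arg_cong[of _ _ Least]) auto

text \<open>If the futures of two positions agree, their distance is a period of a shifted sequence,
  hence of \<open>c\<close> itself, and the least period divides it.\<close>

lemma cong_of_shift_eq:
  assumes c: "periodic c" and eq: "\<And>t. c (x + t) = c (y + t)"
  shows "x mod per c = y mod per c"
proof -
  have *: "x mod per c = y mod per c" if "x \<le> y" "\<And>t. c (x + t) = c (y + t)" for x y
  proof (cases "x = y")
    case False
    have "is_period (\<lambda>t. c (t + x)) (y - x)"
      unfolding is_period_def
    proof
      fix t
      have "t + (y - x) + x = y + t" using that(1) by simp
      then show "c (t + (y - x) + x) = c (t + x)" using that(2)[of t] by (simp add: add.commute)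
    qed
    then have "per c dvd y - x"
      using False that by (intro per_dvd is_period_of_shift[OF c]) auto
    then show ?thesis using mod_eq_dvd_iff_nat[OF that(1)] by metis
  qed simp
  show ?thesis using *[of x y] *[of y x] eq by (metis nle_le)
qed

section \<open>Periodic sequences up to rotation\<close>

definition rot_equiv :: "(nat \<Rightarrow> 'a) \<Rightarrow> (nat \<Rightarrow> 'a) \<Rightarrow> bool" where
  "rot_equiv c d \<longleftrightarrow> (\<exists>j. \<forall>x. c x = d (x + j))"

lemma rot_equiv_refl: "rot_equiv c c"
  by (auto simp: rot_equiv_def intro: exI[of _ 0])

lemma rot_equiv_trans: "rot_equiv a b \<Longrightarrow> rot_equiv b c \<Longrightarrow> rot_equiv a c"
  by (auto simp: rot_equiv_def add.assoc)

lemma rot_equiv_sym: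
  assumes "periodic d" "rot_equiv c d"
  shows "rot_equiv d c"
proof -
  obtain j where j: "\<And>x. c x = d (x + j)" using assms by (auto simp: rot_equiv_def)
  obtain i where i: "\<And>x. d (x + i + j) = d x" using periodic_unshift[OF assms(1)] by metis
  then have "d x = c (x + i)" for x by (simp add: j)
  then show ?thesis by (auto simp: rot_equiv_def)
qed

lemma rot_equiv_of_shift_eq:
  assumes c: "periodic c" and eq: "\<And>t. c (x + t) = d (y + t)"
  shows "rot_equiv c d"
proof -
  obtain i where i: "\<And>t. c (t + i + x) = c t" using periodic_unshift[OF c] by metis
  have "c t = d (t + (i + y))" for t
    using eq[of "t + i"] i[of t] by (simp add: add_ac)
  then show ?thesis by (auto simp: rot_equiv_def)
qed

text \<open>If \<open>n\<close> is a period of \<open>d\<close>, these values order the positions \<open>x\<close> lexicographically by the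
  infinite sequence of digits that starts there.\<close>

fun numeral_at :: "int \<Rightarrow> (nat \<Rightarrow> int) \<Rightarrow> nat \<Rightarrow> nat \<Rightarrow> int" where
  "numeral_at B d 0 x = 0"
| "numeral_at B d (Suc n) x = d x * B ^ n + numeral_at B d n (Suc x)"

lemma numeral_at_snoc: "numeral_at B d (Suc n) x = B * numeral_at B d n x + d (x + n)"
proof (induction n arbitrary: x)
  case (Suc n)
  show ?case
    by (subst numeral_at.simps, subst Suc.IH) (simp add: algebra_simps)
qed simp

lemma numeral_at_nonneg: "B \<ge> 0 \<Longrightarrow> (\<And>x. 0 \<le> d x) \<Longrightarrow> numeral_at B d n x \<ge> 0"
  by (induction n arbitrary: x) auto

lemma numeral_at_less:
  assumes "B \<ge> 1" "\<And>x. d x \<le> B - 2"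
  shows "numeral_at B d n x < B ^ n"
proof (induction n arbitrary: x)
  case (Suc n)
  have "d x * B ^ n \<le> (B - 2) * B ^ n" using assms by (intro mult_right_mono) auto
  moreover have "(B - 2) * B ^ n + 2 * B ^ n = B ^ Suc n" by (simp add: algebra_simps)
  ultimately show ?case
    using Suc.IH[of "Suc x"] assms(1) zero_less_power[of B n] by (simp only: numeral_at.simps) linarith
qed simp

text \<open>Since the digit \<open>B - 1\<close> never occurs, the value can serve as a remainder on
  division by \<open>B ^ n - 1\<close>.\<close>

lemma numeral_at_less_pred:
  assumes B: "B \<ge> 1" "\<And>x. d x \<le> B - 2" and "n \<ge> 1"
  shows "numeral_at B d n x < B ^ n - 1"
proof -
  obtain n' where n: "n = Suc n'" using \<open>n \<ge> 1\<close> by (cases n) auto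
  have "d x * B ^ n' \<le> (B - 2) * B ^ n'" using B by (intro mult_right_mono) auto
  moreover have "(B - 2) * B ^ n' + 2 * B ^ n' = B ^ Suc n'" by (simp add: algebra_simps)
  moreover have "B ^ n' \<ge> 1" using B(1) by (simp add: one_le_power)
  ultimately show ?thesis
    using numeral_at_less[of B d n' "Suc x", OF B] unfolding n numeral_at.simps by linarith
qed

text \<open>\<open>\<phi> x / (B ^ m - 1)\<close> is the number whose base \<open>B\<close>
  expansion is the periodic digit sequence from \<open>x\<close> on. Moving to \<open>Suc x\<close>
  multiplies it by \<open>B\<close> and subtracts the leading digit, which preserves comparisons
  between positions with equal digits.\<close>

lemma exists_ranking:
  fixes w :: "nat \<Rightarrow> 'a"
  assumes m: "m \<ge> 1" "is_period w m"
  obtains \<phi> :: "nat \<Rightarrow> int" where "is_period \<phi> m"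
    and "\<And>x y. w x = w y \<Longrightarrow> \<phi> x \<le> \<phi> y \<longleftrightarrow> \<phi> (Suc x) \<le> \<phi> (Suc y)"
    and "\<And>x y t. \<phi> x = \<phi> y \<Longrightarrow> w (x + t) = w (y + t)"
proof -
  have fin: "finite (range w)" using m by (intro finite_range_periodic) (auto simp: periodic_def)
  then obtain g :: "'a \<Rightarrow> nat" where g: "inj_on g (range w)"
    using finite_imp_inj_to_nat_seg by metis
  define d where "d x = int (g (w x))" for x
  have "finite (range d)"
    using finite_imageI[OF fin, of "\<lambda>a. int (g a)"] by (simp add: d_def[abs_def] image_image)
  \<comment> \<open>One more than the number base needed for the digits: the spare digit
    \<open>B - 1\<close> makes expansions unique.\<close>
  define B where "B = Max (range d) + 2"
  have dB: "d x \<le> B - 2" for x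
    using \<open>finite (range d)\<close> by (simp add: B_def)
  have d0: "d x \<ge> 0" for x by (simp add: d_def)
  have B: "B \<ge> 2" using d0[of 0] dB[of 0] by linarith
  have d_eq: "d x = d y \<longleftrightarrow> w x = w y" for x y
    using g by (auto simp: d_def inj_on_def)
  have dper: "d (x + m) = d x" for x using m(2) by (simp add: d_def is_period_def)
  define \<phi> where "\<phi> = numeral_at B d m"
  \<comment> \<open>By periodicity the digit entering at the end is the one that leaves at the
    front, so the \<open>m\<close> digits are rotated cyclically.\<close>
  have step: "B * \<phi> x = d x * (B ^ m - 1) + \<phi> (Suc x)" for x
    using numeral_at_snoc[of B d m x] by (simp add: \<phi>_def dper[of x, unfolded add.commute[of x]] algebra_simps)
  have bd: "0 \<le> \<phi> x" "\<phi> x < B ^ m - 1" for x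
    using numeral_at_nonneg[of B d] numeral_at_less_pred[of B d m] B d0 dB m by (auto simp: \<phi>_def)
  have eq: "w x = w y \<and> \<phi> (Suc x) = \<phi> (Suc y)" if "\<phi> x = \<phi> y" for x y
  proof -
    \<comment> \<open>The formula in \<open>step\<close> is a division with remainder by
      \<open>B ^ m - 1\<close>, so \<open>\<phi> x\<close> determines both the leading digit and
      \<open>\<phi> (Suc x)\<close>.\<close>
    have *: "d x = B * \<phi> x div (B ^ m - 1)" for x
      using bd(1)[of "Suc x"] bd(2)[of "Suc x"] by (simp add: step div_pos_pos_trivial)
    have "d x = d y" using *[of x] *[of y] that by simp
    then have "\<phi> (Suc x) = \<phi> (Suc y)" using step[of x] step[of y] that by simp
    then show ?thesis using \<open>d x = d y\<close> d_eq by simp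
  qed
  show ?thesis
  proof (rule that[of \<phi>])
    have "numeral_at B d n (x + m) = numeral_at B d n x" for n x
      by (induction n arbitrary: x) (simp_all add: dper flip: add_Suc)
    then show "is_period \<phi> m" by (simp add: is_period_def \<phi>_def)
  next
    fix x y assume "w x = w y"
    then have "d x = d y" by (simp add: d_eq)
    then have "B * \<phi> x \<le> B * \<phi> y \<longleftrightarrow> \<phi> (Suc x) \<le> \<phi> (Suc y)" using step[of x] step[of y] by simp
    then show "\<phi> x \<le> \<phi> y \<longleftrightarrow> \<phi> (Suc x) \<le> \<phi> (Suc y)" using B by simp
  next
    fix x y t assume "\<phi> x = \<phi> y"
    then have "\<phi> (x + t) = \<phi> (y + t)"
    proof (induction t)
      case (Suc t)
      then show ?case using eq[of "x + t" "y + t"] by simp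
    qed simp
    then show "w (x + t) = w (y + t)" using eq by blast
  qed
qed

subsection \<open>Long loops in a deterministic graph\<close>

lemma card_noninjective_part:
  assumes E: "finite E" "card E \<le> card (h ` E) + b"
  shows "card {e \<in> E. \<exists>e'\<in>E. e' \<noteq> e \<and> h e' = h e} \<le> 2 * b"
proof -
  define R where "R = {e \<in> E. \<exists>e'\<in>E. e' \<noteq> e \<and> h e' = h e}"
  have R: "R \<subseteq> E" "finite R" using E by (auto simp: R_def)
  have inj: "e = e'" if "e \<in> E - R" "e' \<in> E" "h e' = h e" for e e'
    using that unfolding R_def by fastforce
  have "card (h ` E) = card (h ` (E - R)) + card (h ` R)"
  proof -
    have "h e \<notin> h ` R" if "e \<in> E - R" for e
      using inj[OF that] R(1) that by (metis DiffD2 imageE subsetD)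
    then have "h ` (E - R) \<inter> h ` R = {}" by auto
    then have "card (h ` (E - R)) + card (h ` R) = card (h ` (E - R) \<union> h ` R)"
      using E(1) R(2) by (simp add: card_Un_disjoint)
    also have "\<dots> = card (h ` E)" using R(1) by (simp add: image_Un[symmetric] Un_absorb2)
    finally show ?thesis by simp
  qed
  moreover have "card (h ` (E - R)) = card (E - R)"
    using inj by (intro card_image inj_onI) (metis DiffD1)
  moreover have "card E = card (E - R) + card R"
    using R E(1) by (simp add: card_Diff_subset card_mono)
  moreover have "2 * card (h ` R) \<le> card R"
  proof -
    have "2 * card (h ` R) = (\<Sum>v\<in>h ` R. 2)" by simp
    also have "\<dots> \<le> (\<Sum>v\<in>h ` R. card {e \<in> R. h e = v})"
    proof (rule sum_mono)
      fix v assume "v \<in> h ` R"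
      then obtain e where e: "e \<in> R" "v = h e" by blast
      then obtain e' where e': "e' \<in> E" "e' \<noteq> e" "h e' = h e" by (auto simp: R_def)
      have "e \<in> E" using e(1) R(1) by blast
      then have "e' \<in> R" using e' unfolding R_def by (auto intro: bexI[of _ e])
      then have "{e, e'} \<subseteq> {e \<in> R. h e = v}" using e e' by auto
      from card_mono[OF _ this] e'(2) R(2) show "2 \<le> card {e \<in> R. h e = v}" by simp
    qed
    also have "\<dots> = card R"
      using sum.image_gen[OF R(2), of "\<lambda>_. 1::nat" h] by simp
    finally show ?thesis .
  qed
  ultimately show ?thesis unfolding R_def[symmetric] using E(2) by linarith
qed

text \<open>A weak form of the Fine-Wilf theorem. On a window of length \<open>2 * q\<close> every
  residue modulo \<open>q\<close> can be advanced by \<open>p\<close> without leaving the window, so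
  \<open>u\<close> inherits the period \<open>p\<close> of \<open>v\<close>.\<close>

lemma periodic_agree:
  assumes u: "is_period u q" and v: "is_period v p" and p: "1 \<le> p" "p \<le> q"
    and eq: "\<And>t. t < 2 * q \<Longrightarrow> u t = v t"
  shows "u t = v t"
proof -
  have "u (t + p) = u t" for t
  proof -
    have lt: "t mod q < q" using p by simp
    have "u (t + p) = u (t mod q + p)"
      by (rule is_period_cong[OF u]) (simp add: mod_add_left_eq)
    also have "\<dots> = v (t mod q + p)" using lt p by (intro eq) linarith
    also have "\<dots> = v (t mod q)" by (rule is_period_add[OF v])
    also have "\<dots> = u (t mod q)" using lt by (intro eq[symmetric]) simp
    also have "\<dots> = u t" by (rule is_period_mod[OF u])
    finally show ?thesis .
  qed
  then have "is_period u p" by (simp add: is_period_def)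
  then have "u t = u (t mod p)" by (rule is_period_mod[symmetric])
  moreover have "t mod p < p" using p by simp
  ultimately show ?thesis using eq[of "t mod p"] p is_period_mod[OF v] by simp
qed

definition loop :: "('v, 'e) pre_digraph \<Rightarrow> (nat \<Rightarrow> 'e) \<Rightarrow> bool" where
  "loop G c \<longleftrightarrow> periodic c \<and> (\<forall>x. c x \<in> arcs G \<and> head G (c x) = tail G (c (Suc x)))"

text \<open>Away from these edges, walks inside \<open>E\<close> can be traced backwards uniquely: a
  walk that arrives at the head of such an edge has just traversed it.\<close>

definition merging :: "('v, 'e) pre_digraph \<Rightarrow> 'e set \<Rightarrow> 'e set" where
  "merging G E = {e \<in> E. \<exists>e'\<in>E. e' \<noteq> e \<and> head G e' = head G e}"

text \<open>The target of the immersion enters only through the labels it induces on edges. As in a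
  deterministic automaton, a starting vertex and a sequence of labels admit at most one
  path.\<close>

locale deterministic_digraph = wf_digraph G for G :: "('v, 'e) pre_digraph" +
  fixes lab :: "'e \<Rightarrow> 'f"
  assumes inj_lab: "v \<in> verts G \<Longrightarrow> inj_on lab (out_arcs G v)"
begin

lemma eq_of_label_eq:
  assumes c: "loop G c" and d: "loop G d" and start: "tail G (c x) = tail G (d y)"
    and eq: "\<And>t. lab (c (x + t)) = lab (d (y + t))"
  shows "c (x + t) = d (y + t)"
proof -
  have arc: "c x \<in> arcs G" "d x \<in> arcs G" for x using c d by (auto simp: loop_def)
  have step: "c (x + t) = d (y + t)" if "tail G (c (x + t)) = tail G (d (y + t))" for t
    using inj_onD[OF inj_lab[of "tail G (c (x + t))"] eq[of t]] arc that by simp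
  have "tail G (c (x + t)) = tail G (d (y + t))"
  proof (induction t)
    case (Suc t)
    then show ?case using step[of t] c d unfolding loop_def by (metis add_Suc_right)
  qed (simp add: start)
  then show ?thesis by (rule step)
qed

text \<open>
  Positions of \<open>c\<close> are ranked by their label futures. Along a traversal of an edge that is
  not merging, a position of top rank over its vertex is followed by another one, and every
  edge is left from only one position of top rank. The positions where \<open>\<phi>\<close> is maximal recur
  with the label period, so one of them is followed by two label periods free of merging edges.
\<close>

lemma exists_stretch:
  assumes c: "loop G c" and E: "finite E" "range c \<subseteq> E" and b: "card (merging G E) \<le> 2 * b"
    and long: "12 * b * per (lab \<circ> c) \<le> per c"
  obtains x where "\<And>t. t < 2 * per (lab \<circ> c) \<Longrightarrow> c (x + t) \<notin> merging G E"
proof (cases "b = 0")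
  \<comment> \<open>No edge is merging when \<open>b = 0\<close>, so every position will do.\<close>
  case True
  moreover have "finite (merging G E)" using E by (simp add: merging_def)
  ultimately show ?thesis using b that by auto
next
  case False
  define w where "w = lab \<circ> c"
  define m where "m = per w"
  have pc: "periodic c" using c by (simp add: loop_def)
  then have pw: "periodic w" by (simp add: w_def periodic_comp)
  have m: "m \<ge> 1" "is_period w m" using per_ge_1[OF pw] per_period[OF pw] by (simp_all add: m_def)
  from exists_ranking[OF m] obtain \<phi> :: "nat \<Rightarrow> int" where \<phi>: "is_period \<phi> m"
    "\<And>x y. w x = w y \<Longrightarrow> \<phi> x \<le> \<phi> y \<longleftrightarrow> \<phi> (Suc x) \<le> \<phi> (Suc y)"
    "\<And>x y t. \<phi> x = \<phi> y \<Longrightarrow> w (x + t) = w (y + t)" by blast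
  obtain a where a: "\<And>y. \<phi> y \<le> \<phi> a"
  proof -
    have "\<phi> 0 \<in> \<phi> ` {..<m}" using m(1) by (intro imageI) simp
    then have fin: "finite (\<phi> ` {..<m})" "\<phi> ` {..<m} \<noteq> {}" by auto
    from Max_in[OF fin] obtain a where "Max (\<phi> ` {..<m}) = \<phi> a" by (rule imageE)
    moreover have "\<phi> y \<le> Max (\<phi> ` {..<m})" for y
      using is_period_mod[OF \<phi>(1), of y] m by (intro Max_ge) (auto intro!: image_eqI[of _ _ "y mod m"])
    ultimately show ?thesis using that by metis
  qed
  \<comment> \<open>The positions after which top rank can be lost: the edge is merging, and the
    position is the highest one on that edge.\<close>
  define cut where "cut x \<longleftrightarrow> c x \<in> merging G E \<and> (\<forall>y. c y = c x \<longrightarrow> \<phi> y \<le> \<phi> x)" for x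
  \<comment> \<open>Two cuts on one edge have equal rank, hence equal label futures, hence equal
    futures by determinism. So each merging edge carries at most one cut per period of
    \<open>c\<close>.\<close>
  have cut_inj: "x mod per c = y mod per c" if "cut x" "cut y" "c x = c y" for x y
  proof -
    have "\<phi> x = \<phi> y" using that unfolding cut_def by (metis order_antisym)
    then have "w (x + t) = w (y + t)" for t by (rule \<phi>(3))
    then have "c (x + t) = c (y + t)" for t
      using eq_of_label_eq[OF c c, of x y] that(3) by (simp add: w_def)
    then show ?thesis by (rule cong_of_shift_eq[OF pc])
  qed
  define n where "n = per c div m"
  have "m dvd per c"
    unfolding m_def using per_ge_1[OF pc] per_period[OF pc]
    by (intro per_dvd) (simp_all add: w_def is_period_comp)
  then have k: "per c = n * m" by (simp add: n_def)
  have n: "12 * b \<le> n" using long m(1) by (simp add: k w_def[symmetric] m_def[symmetric])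
  \<comment> \<open>Pigeonhole: one period of \<open>c\<close> contains
    \<open>n div 2 \<ge> 6 * b\<close> disjoint blocks of length \<open>2 * m\<close> starting at
    positions of maximal rank, but there are at most \<open>2 * b\<close> cuts, fewer since
    \<open>b > 0\<close>.\<close>
  have "\<exists>j<n div 2. \<forall>t<2 * m. \<not> cut (a + 2 * j * m + t)"
  proof (rule ccontr)
    assume "\<not> ?thesis"
    then obtain t where t: "\<And>j. j < n div 2 \<Longrightarrow> t j < 2 * m \<and> cut (a + 2 * j * m + t j)"
      by metis
    have "inj_on (\<lambda>j. c (a + 2 * j * m + t j)) {..<n div 2}"
    proof (rule inj_onI)
      fix i j assume ij: "i \<in> {..<n div 2}" "j \<in> {..<n div 2}"
        and "c (a + 2 * i * m + t i) = c (a + 2 * j * m + t j)"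
      then have "(a + (2 * m * i + t i)) mod per c = (a + (2 * m * j + t j)) mod per c"
        using cut_inj t by (simp add: algebra_simps)
      then have "(2 * m * i + t i) mod per c = (2 * m * j + t j) mod per c"
        using mod_add_lcancel_nat by blast
      moreover have "2 * m * i + t i < per c" if "i < n div 2" for i
      proof -
        have "2 * m * i + t i < 2 * m * Suc i" using t[OF that] by simp
        also have "\<dots> \<le> 2 * m * (n div 2)" using that by (intro mult_le_mono2) simp
        also have "\<dots> \<le> m * n" by (simp add: mult.commute[of 2] mult.assoc)
        finally show ?thesis by (simp add: k mult.commute)
      qed
      ultimately have "2 * m * i + t i = 2 * m * j + t j" using ij by simp
      then have "(2 * m * i + t i) div (2 * m) = (2 * m * j + t j) div (2 * m)" by simp
      then show "i = j" using t[of i] t[of j] ij by (simp add: m(1))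
    qed
    moreover have "(\<lambda>j. c (a + 2 * j * m + t j)) ` {..<n div 2} \<subseteq> merging G E"
      using t by (auto simp: cut_def)
    moreover have "finite (merging G E)" using E by (simp add: merging_def)
    ultimately have "n div 2 \<le> card (merging G E)" using card_inj_on_le by fastforce
    then show False using b n False by linarith
  qed
  then obtain j where j: "\<And>t. t < 2 * m \<Longrightarrow> \<not> cut (a + 2 * j * m + t)" by blast
  define x where "x = a + 2 * j * m"
  \<comment> \<open>The start \<open>x\<close> has maximal rank among all positions. In the
    inductive step the absence of a cut shows that \<open>c (x + t)\<close> is not merging, so every
    position over the next vertex has a predecessor on this same edge, and the order is carried
    forwards.\<close>
  have top: "\<phi> y \<le> \<phi> (x + t)" if "t \<le> 2 * m" "tail G (c y) = tail G (c (x + t))" for t y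
    using that
  proof (induction t arbitrary: y)
    case 0
    have "\<phi> x = \<phi> a" unfolding x_def by (rule is_period_cong[OF \<phi>(1)]) simp
    then show ?case using a by simp
  next
    case (Suc t)
    \<comment> \<open>The predecessor of \<open>y\<close>, taken one period later because
      \<open>y\<close> may be 0.\<close>
    obtain z where z: "c (Suc z) = c y" "\<phi> (Suc z) = \<phi> y"
    proof -
      have "is_period c (per c)" "is_period \<phi> (per c)"
        using per_period[OF pc] is_period_mult[OF \<phi>(1), of n] by (simp_all add: k mult.commute[of n])
      then have "c (Suc (y + per c - 1)) = c y" "\<phi> (Suc (y + per c - 1)) = \<phi> y"
        using per_ge_1[OF pc] by (simp_all add: is_period_def)
      then show ?thesis using that by blast
    qed
    have same_head: "head G (c z) = head G (c (x + t))"
      using c Suc.prems(2) z(1) unfolding loop_def by (metis add_Suc_right)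
    have IH: "\<phi> y' \<le> \<phi> (x + t)" if "c y' = c (x + t)" for y'
      using Suc.IH[of y'] Suc.prems(1) that by simp
    then have "c (x + t) \<notin> merging G E"
      using j[of t] Suc.prems(1) by (auto simp: cut_def x_def)
    then have "c z = c (x + t)"
      using same_head E(2) by (auto simp: merging_def)
    then have "\<phi> (Suc z) \<le> \<phi> (Suc (x + t))"
      using \<phi>(2)[of z "x + t"] IH by (simp add: w_def)
    then show ?case by (simp add: z)
  qed
  show ?thesis
  proof (rule that[of x])
    fix t assume "t < 2 * per (lab \<circ> c)"
    then show "c (x + t) \<notin> merging G E"
      using j[of t] top[of t] by (auto simp: cut_def m_def w_def x_def)
  qed
qed

text \<open>The private edge is the last one of a stretch without merging edges in a loop of largest
  label period. Any loop of the family through it is forced backwards along the stretch, which is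
  long enough to identify the two loops up to rotation.\<close>

lemma exists_private_arc:
  assumes F: "finite F" "F \<noteq> {}" "\<And>c. c \<in> F \<Longrightarrow> loop G c"
    and ineq: "\<And>c d. c \<in> F \<Longrightarrow> d \<in> F \<Longrightarrow> rot_equiv c d \<Longrightarrow> c = d"
    and long: "\<And>c. c \<in> F \<Longrightarrow> 12 * b * per (lab \<circ> c) \<le> per c"
    and merging: "card (merging G (\<Union>c\<in>F. range c)) \<le> 2 * b"
  shows "\<exists>c\<in>F. \<exists>e\<in>range c. \<forall>d\<in>F. e \<in> range d \<longrightarrow> d = c"
proof -
  define E where "E = (\<Union>c\<in>F. range c)"
  have per: "periodic c" if "c \<in> F" for c using F(3)[OF that] by (simp add: loop_def)
  have "finite (range c)" if "c \<in> F" for c using per[OF that] by (rule finite_range_periodic)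
  then have finE: "finite E" using F(1) by (simp add: E_def)
  define p where "p c = per (lab \<circ> c)" for c
  have "Max (p ` F) \<in> p ` F" using F by (intro Max_in) auto
  then obtain c where c: "c \<in> F" "p c = Max (p ` F)" by auto
  \<comment> \<open>Maximality makes the stretch, two label periods of \<open>c\<close>, long enough
    for comparison with every \<open>d\<close> in \<open>F\<close>.\<close>
  have pmax: "p d \<le> p c" if "d \<in> F" for d using that F(1) by (simp add: c(2))
  have plab: "periodic (lab \<circ> d)" if "d \<in> F" for d using per[OF that] by (rule periodic_comp)
  have p1: "p d \<ge> 1" if "d \<in> F" for d unfolding p_def using plab[OF that] by (rule per_ge_1)
  have "range c \<subseteq> E" using c by (auto simp: E_def)
  from exists_stretch[OF F(3)[OF c(1)] finE this merging[folded E_def] long[OF c(1)]]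
  obtain x where x: "\<And>t. t < 2 * p c \<Longrightarrow> c (x + t) \<notin> merging G E" by (auto simp: p_def)
  define l where "l = 2 * p c - 1"
  have l: "2 * p c = Suc l" using p1[OF c(1)] by (simp add: l_def)
  have "d = c" if d: "d \<in> F" "c (x + l) \<in> range d" for d
  proof -
    \<comment> \<open>Adding periods of \<open>d\<close> leaves room for \<open>l\<close> steps
      backwards from \<open>y\<close>.\<close>
    obtain y where y: "l \<le> y" "d y = c (x + l)"
    proof -
      obtain y where "c (x + l) = d y" using d(2) by auto
      moreover have "d (y + per d * l) = d y"
        using is_period_mult[OF per_period[OF per[OF d(1)]]] by (simp add: is_period_def)
      moreover have "l \<le> y + per d * l" using per_ge_1[OF per[OF d(1)]] by (simp add: trans_le_add2)
      ultimately show ?thesis using that by metis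
    qed
    \<comment> \<open>Backwards induction: the edge before is determined by its head, because that
      edge of \<open>c\<close> is not merging and both loops stay inside \<open>E\<close>.\<close>
    have traced: "d (y - s) = c (x + l - s)" if "s \<le> l" for s
      using that
    proof (induction s)
      case (Suc s)
      have "Suc (y - Suc s) = y - s" "Suc (x + l - Suc s) = x + l - s" using Suc.prems y(1) by auto
      then have "head G (d (y - Suc s)) = head G (c (x + l - Suc s))"
        using Suc F(3)[OF d(1)] F(3)[OF c(1)] unfolding loop_def by (metis Suc_leD)
      moreover have "c (x + l - Suc s) \<notin> merging G E"
        using x[of "l - Suc s"] l Suc.prems by simp
      moreover have "d (y - Suc s) \<in> E" "c (x + l - Suc s) \<in> E"
        using c(1) d(1) by (auto simp: E_def)
      ultimately show ?case by (auto simp: merging_def)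
    qed (simp add: y)
    define z where "z = y - l"
    have agrees: "c (x + t) = d (z + t)" if "t < 2 * p c" for t
      using traced[of "l - t"] that l y(1) by (simp add: z_def)
    have "lab (c (x + t)) = lab (d (z + t))" for t
    proof (rule periodic_agree[where u = "\<lambda>t. lab (c (x + t))" and v = "\<lambda>t. lab (d (z + t))"
        and q = "p c" and p = "p d"])
      have sh: "is_period (\<lambda>t. lab (d (z + t))) (p d)" if "d \<in> F" for d z
        using is_period_shift[OF per_period[OF plab[OF that]], of z] by (simp add: p_def add.commute)
      show "is_period (\<lambda>t. lab (c (x + t))) (p c)" "is_period (\<lambda>t. lab (d (z + t))) (p d)"
        using sh[OF c(1)] sh[OF d(1)] by auto
    qed (use p1 pmax d agrees in auto)
    then have "c (x + t) = d (z + t)" for t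
      using eq_of_label_eq[OF F(3)[OF c(1)] F(3)[OF d(1)], of x z] agrees[of 0] l by simp
    then have "rot_equiv c d" using per c(1) by (intro rot_equiv_of_shift_eq)
    then show ?thesis using ineq c(1) d(1) by blast
  qed
  then show ?thesis using c(1) by blast
qed

end

subsection \<open>Independence of loops in homology\<close>

context vector_space
begin

text \<open>A linear functional that is nonzero at \<open>u\<close> allows projection along
  \<open>u\<close> onto its kernel. The projected vectors together with \<open>u\<close> still span
  \<open>U\<close>, so at most one dimension is lost.\<close>

lemma exists_independent_in_kernel:
  fixes \<phi> :: "'b \<Rightarrow> 'a"
  assumes U: "finite U" "independent U"
    and add: "\<And>x y. \<phi> (x + y) = \<phi> x + \<phi> y" and scale: "\<And>c x. \<phi> (c *s x) = c * \<phi> x"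
  obtains W where "finite W" "independent W" "W \<subseteq> span U" "\<And>x. x \<in> W \<Longrightarrow> \<phi> x = 0"
    "card U \<le> card W + 1"
proof (cases "\<forall>x\<in>U. \<phi> x = 0")
  case True
  then show ?thesis using that[of U] U span_superset by auto
next
  case False
  then obtain u where u: "u \<in> U" "\<phi> u \<noteq> 0" by blast
  define p where "p x = x - (\<phi> x / \<phi> u) *s u" for x
  have minus: "\<phi> (x - y) = \<phi> x - \<phi> y" for x y
    using add[of "x - y" y] by (simp add: algebra_simps)
  obtain W where W: "W \<subseteq> p ` U" "independent W" "p ` U \<subseteq> span W"
    using maximal_independent_subset by metis
  have "finite W" using W U finite_subset by blast
  have "U \<subseteq> span (insert u W)"
  proof
    fix x assume "x \<in> U"
    then have "p x \<in> span (insert u W)" using W span_mono[of W "insert u W"] by auto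
    moreover have "(\<phi> x / \<phi> u) *s u \<in> span (insert u W)" by (intro span_scale span_base) simp
    ultimately have "p x + (\<phi> x / \<phi> u) *s u \<in> span (insert u W)" by (rule span_add)
    then show "x \<in> span (insert u W)" by (simp add: p_def)
  qed
  then have "card U \<le> card (insert u W)"
    using independent_span_bound[of "insert u W" U] U \<open>finite W\<close> by auto
  also have "\<dots> \<le> card W + 1" using \<open>finite W\<close> by (simp add: card_insert_if)
  finally have "card U \<le> card W + 1" .
  moreover have "p x \<in> span U" if "x \<in> U" for x
    unfolding p_def using that u by (intro span_diff span_scale span_base)
  moreover have "\<phi> (p x) = 0" for x
    using u by (simp add: p_def minus scale)
  ultimately show ?thesis using that[of W] W \<open>finite W\<close> by blast
qed

lemma exists_independent_in_kernels:
  fixes \<phi> :: "'i \<Rightarrow> 'b \<Rightarrow> 'a"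
  assumes V: "finite V" and U: "finite U" "independent U"
    and add: "\<And>v x y. \<phi> v (x + y) = \<phi> v x + \<phi> v y"
    and scale: "\<And>v c x. \<phi> v (c *s x) = c * \<phi> v x"
  obtains W where "finite W" "independent W" "W \<subseteq> span U" "\<And>v x. v \<in> V \<Longrightarrow> x \<in> W \<Longrightarrow> \<phi> v x = 0"
    "card U \<le> card W + card V"
proof -
  have "\<exists>W. finite W \<and> independent W \<and> W \<subseteq> span U \<and> (\<forall>v\<in>V. \<forall>x\<in>W. \<phi> v x = 0) \<and>
    card U \<le> card W + card V"
    using V
  proof (induction V rule: finite_induct)
    case empty
    then show ?case using U span_superset by auto
  next
    case (insert v V)
    then obtain W where W: "finite W" "independent W" "W \<subseteq> span U"
      "\<forall>v\<in>V. \<forall>x\<in>W. \<phi> v x = 0" "card U \<le> card W + card V" by blast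
    from exists_independent_in_kernel[OF W(1,2), of "\<phi> v"] add scale
    obtain W' where W': "finite W'" "independent W'" "W' \<subseteq> span W" "\<And>x. x \<in> W' \<Longrightarrow> \<phi> v x = 0"
      "card W \<le> card W' + 1" by metis
    have sub: "span W \<subseteq> span U" using W(3) span_minimal subspace_span by blast
    \<comment> \<open>Passing to the next kernel stays inside the span of \<open>W\<close>, where
      the functionals already treated vanish.\<close>
    have "\<phi> u x = 0" if "u \<in> V" "x \<in> W'" for u x
    proof -
      have "subspace {x. \<phi> u x = 0}"
        using scale[of u 0 0] by (auto intro!: subspaceI simp: add scale)
      then have "span W \<subseteq> {x. \<phi> u x = 0}" using W(4) that(1) by (intro span_minimal) auto
      then show ?thesis using that W'(3) by blast
    qed
    then show ?case using W W' sub insert.hyps by (intro exI[of _ W']) auto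
  qed
  then show ?thesis using that by blast
qed

end

section \<open>Finitely supported chains and the Betti number\<close>

lemma boundary_eq_sum:
  assumes "finite E" "{e. x e \<noteq> 0} \<subseteq> E"
  shows "boundary G x v = (\<Sum>e\<in>E. if head G e = v then x e else 0) -
    (\<Sum>e\<in>E. if tail G e = v then x e else 0)"
proof -
  have "(\<Sum>e | x e \<noteq> 0 \<and> P e. x e) = (\<Sum>e\<in>E. if P e then x e else 0)" for P
  proof -
    have "(\<Sum>e | x e \<noteq> 0 \<and> P e. x e) = (\<Sum>e\<in>{e\<in>E. P e}. x e)"
      using assms by (intro sum.mono_neutral_left) auto
    then show ?thesis using assms(1) by (simp add: sum.inter_filter)
  qed
  then show ?thesis by (simp add: boundary_def)
qed

lemma betti1_ge_card:
  "finite B \<Longrightarrow> B \<subseteq> H1 G \<Longrightarrow> chain.independent B \<Longrightarrow> enat (card B) \<le> betti1 G"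
  unfolding betti1_def by (rule SUP_upper) simp

definition arc_chain :: "'e \<Rightarrow> 'e \<Rightarrow> rat" where
  "arc_chain e e' = of_bool (e' = e)"

text \<open>A triangularity argument: a member with a private coordinate \<open>e\<close> lies
  outside the hyperplane \<open>x e = 0\<close> that contains the span of all others, and the rest
  is handled by induction.\<close>

lemma independent_of_private:
  fixes z :: "'c \<Rightarrow> 'e \<Rightarrow> rat"
  assumes "finite F"
    and "\<And>F'. F' \<subseteq> F \<Longrightarrow> F' \<noteq> {} \<Longrightarrow> \<exists>c\<in>F'. \<exists>e. z c e \<noteq> 0 \<and> (\<forall>d\<in>F' - {c}. z d e = 0)"
  shows "chain.independent (z ` F) \<and> card (z ` F) = card F"
  using assms
proof (induction "card F" arbitrary: F)
  case (Suc n)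
  then obtain c e where c: "c \<in> F" "z c e \<noteq> 0" "\<forall>d\<in>F - {c}. z d e = 0"
    by (metis card.empty nat.distinct(1) order_refl)
  define F' where "F' = F - {c}"
  have F: "F = insert c F'" "c \<notin> F'" "finite F'" using c(1) Suc.prems(1) by (auto simp: F'_def)
  have "n = card F'" using Suc.hyps(2) F by simp
  then have IH: "chain.independent (z ` F') \<and> card (z ` F') = card F'"
    using F(1,3) Suc.prems(2) by (intro Suc.hyps(1)) (auto simp: subset_insertI2)
  have "chain.subspace {x. x e = 0}" by (auto intro!: chain.subspaceI)
  moreover have "z ` F' \<subseteq> {x. x e = 0}" using c(3) by (auto simp: F'_def)
  ultimately have "chain.span (z ` F') \<subseteq> {x. x e = 0}" by (intro chain.span_minimal)
  then have new: "z c \<notin> chain.span (z ` F')" using c(2) by auto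
  then have "z c \<notin> z ` F'" using chain.span_base by blast
  then show ?case using new IH F by (simp add: chain.independent_insertI)
qed (simp add: chain.independent_empty)

lemma arc_chain_independent:
  assumes "finite E"
  shows "chain.independent (arc_chain ` E)" "card (arc_chain ` E) = card E"
  using independent_of_private[OF assms, of arc_chain] by (fastforce simp: arc_chain_def)+

text \<open>The cycle condition at each vertex lowers the dimension of the space of 1-chains by at most one.\<close>

lemma card_arcs_le_verts_plus_betti1:
  fixes G :: "('v, 'e) pre_digraph"
  assumes E: "finite E" "E \<subseteq> arcs G" and tl: "tail G ` E \<subseteq> head G ` E"
  shows "enat (card E) \<le> enat (card (head G ` E)) + betti1 G"
proof -
  \<comment> \<open>The boundary at \<open>v\<close> of chains supported in \<open>E\<close>.
    Summing over all of \<open>E\<close> instead of the support makes it a linear functional on all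
    chains.\<close>
  define \<phi> where "\<phi> v x = (\<Sum>e\<in>E. if head G e = v then x e else 0) -
    (\<Sum>e\<in>E. if tail G e = v then x e else 0 :: rat)" for v and x :: "'e \<Rightarrow> rat"
  have "\<phi> v (x + y) = \<phi> v x + \<phi> v y" for v x y
    by (simp add: \<phi>_def sum.distrib[symmetric] sum_subtractf[symmetric] if_distrib cong: if_cong)
       (intro sum.cong refl, simp)
  moreover have "\<phi> v (\<lambda>e. c * x e) = c * \<phi> v x" for v c x
    by (simp add: \<phi>_def sum_distrib_left right_diff_distrib if_distrib cong: if_cong)
  moreover have "finite (head G ` E)" "finite (arc_chain ` E)" using E by auto
  ultimately obtain W where W: "finite W" "chain.independent W" "W \<subseteq> chain.span (arc_chain ` E)"
    "\<And>v x. v \<in> head G ` E \<Longrightarrow> x \<in> W \<Longrightarrow> \<phi> v x = 0"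
    "card (arc_chain ` E) \<le> card W + card (head G ` E)"
    using chain.exists_independent_in_kernels[of "head G ` E" "arc_chain ` E" \<phi>]
      arc_chain_independent[OF E(1)] by metis
  have "chain.span (arc_chain ` E) \<subseteq> {x. \<forall>e. e \<notin> E \<longrightarrow> x e = 0}"
    by (intro chain.span_minimal) (auto intro!: chain.subspaceI simp: arc_chain_def)
  then have supp: "{e. x e \<noteq> 0} \<subseteq> E" if "x \<in> W" for x using W(3) that by blast
  have "W \<subseteq> H1 G"
  proof
    fix x assume x: "x \<in> W"
    have "boundary G x v = 0" for v
    proof (cases "v \<in> head G ` E")
      case True
      then show ?thesis using W(4) x by (simp add: boundary_eq_sum[OF E(1) supp[OF x]] \<phi>_def)
    next
      \<comment> \<open>By \<open>tl\<close> no edge of \<open>E\<close> begins or ends at such a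
        vertex.\<close>
      case False
      then have "\<forall>e\<in>E. head G e \<noteq> v \<and> tail G e \<noteq> v" using tl by auto
      then show ?thesis by (simp add: boundary_eq_sum[OF E(1) supp[OF x]])
    qed
    then show "x \<in> H1 G" using supp[OF x] E finite_subset by (auto simp: H1_def)
  qed
  then have "enat (card W) \<le> betti1 G" using W by (intro betti1_ge_card)
  moreover have "enat (card E) \<le> enat (card (head G ` E)) + enat (card W)"
    using W(5) arc_chain_independent(2)[OF E(1)] by simp
  ultimately show ?thesis using add_left_mono order_trans by blast
qed

text \<open>The 1-cycle of a single turn: each edge is counted as often as it is traversed in one
  least period.\<close>

definition loop_chain :: "(nat \<Rightarrow> 'e) \<Rightarrow> 'e \<Rightarrow> rat" where
  "loop_chain c e = (\<Sum>x<per c. of_bool (c x = e))"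

text \<open>All multiplicities are nonnegative, so nothing cancels.\<close>

lemma loop_chain_nonzero_iff: "periodic c \<Longrightarrow> loop_chain c e \<noteq> 0 \<longleftrightarrow> e \<in> range c"
  by (auto simp: loop_chain_def sum_nonneg_eq_0_iff range_periodic)

text \<open>Over one period a loop enters each vertex as often as it leaves it, since heads are the
  tails shifted by one position.\<close>

lemma loop_chain_in_H1:
  fixes G :: "('v, 'e) pre_digraph"
  assumes "loop G c"
  shows "loop_chain c \<in> H1 G"
proof -
  have c: "periodic c" using assms by (simp add: loop_def)
  have supp: "{e. loop_chain c e \<noteq> 0} = range c" using loop_chain_nonzero_iff[OF c] by auto
  have fin: "finite (range c)" using c by (rule finite_range_periodic)
  have "boundary G (loop_chain c) v = 0" for v
  proof -
    \<comment> \<open>Exchanging the sums turns a weighted sum over edges into a count of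
      positions.\<close>
    have *: "(\<Sum>e\<in>range c. if h e = v then loop_chain c e else 0) = (\<Sum>x<per c. of_bool (h (c x) = v))"
      for h :: "'e \<Rightarrow> 'v"
    proof -
      have "(\<Sum>e\<in>range c. if h e = v then loop_chain c e else 0) =
        (\<Sum>e\<in>range c. \<Sum>x<per c. of_bool (c x = e \<and> h e = v))"
        by (intro sum.cong) (auto simp: loop_chain_def)
      also have "\<dots> = (\<Sum>x<per c. \<Sum>e\<in>range c. of_bool (c x = e \<and> h e = v))"
        by (rule sum.swap)
      also have "\<dots> = (\<Sum>x<per c. of_bool (h (c x) = v))"
      proof (rule sum.cong[OF refl])
        fix x
        have "(\<Sum>e\<in>range c. of_bool (c x = e \<and> h e = v) :: rat) =
          (\<Sum>e\<in>range c. if c x = e then of_bool (h e = v) else 0)"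
          by (intro sum.cong) auto
        then show "(\<Sum>e\<in>range c. of_bool (c x = e \<and> h e = v) :: rat) = of_bool (h (c x) = v)"
          using fin by (simp add: sum.delta)
      qed
      finally show ?thesis .
    qed
    define g :: "nat \<Rightarrow> rat" where "g x = of_bool (tail G (c x) = v)" for x
    have "g (per c) = g 0"
      using per_period[OF c] by (simp add: g_def is_period_def) (metis add_0)
    then have "(\<Sum>x<per c. g (Suc x)) = (\<Sum>x<per c. g x)"
      using sum.lessThan_Suc_shift[of g "per c"] by simp
    moreover have "(of_bool (head G (c x) = v) :: rat) = g (Suc x)" for x
      using assms by (simp add: loop_def g_def)
    ultimately show ?thesis
      by (simp add: boundary_eq_sum[OF fin equalityD1[OF supp]] * g_def[symmetric])
  qed
  then show ?thesis using assms supp fin by (auto simp: H1_def loop_def)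
qed

context deterministic_digraph
begin

text \<open>Private edges in every nonempty subfamily make the chains of the loops linearly
  independent in \<open>H1 G\<close>.\<close>

lemma card_inequivalent_long_loops_le:
  assumes b: "betti1 G = enat b"
    and F: "finite F" "\<And>c. c \<in> F \<Longrightarrow> loop G c"
    and ineq: "\<And>c d. c \<in> F \<Longrightarrow> d \<in> F \<Longrightarrow> rot_equiv c d \<Longrightarrow> c = d"
    and long: "\<And>c. c \<in> F \<Longrightarrow> 12 * b * per (lab \<circ> c) \<le> per c"
  shows "card F \<le> b"
proof -
  have per: "periodic c" if "c \<in> F" for c using F(2)[OF that] by (simp add: loop_def)
  have "\<exists>c\<in>F'. \<exists>e. loop_chain c e \<noteq> 0 \<and> (\<forall>d\<in>F' - {c}. loop_chain d e = 0)"
    if F': "F' \<subseteq> F" "F' \<noteq> {}" for F'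
  proof -
    define E where "E = (\<Union>c\<in>F'. range c)"
    have "finite F'" using F' F(1) finite_subset by blast
    moreover have "finite (range c)" if "c \<in> F'" for c
      using that F' per by (intro finite_range_periodic) auto
    ultimately have E: "finite E" by (simp add: E_def)
    have "E \<subseteq> arcs G" using F' F(2) by (auto simp: E_def loop_def)
    \<comment> \<open>Each edge of a loop is preceded by another one, again taken one period later
      to avoid position -1.\<close>
    moreover have "tail G ` E \<subseteq> head G ` E"
    proof
      fix v assume "v \<in> tail G ` E"
      then obtain c x where c: "c \<in> F'" "v = tail G (c x)" by (auto simp: E_def)
      then have "loop G c" "is_period c (per c)" "per c \<ge> 1"
        using F'(1) F(2) per[THEN per_period] per[THEN per_ge_1] by (simp_all add: subset_iff)
      then have "head G (c (x + per c - 1)) = tail G (c x)"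
        by (simp add: loop_def is_period_def)
      then show "v \<in> head G ` E" using c by (auto simp: E_def intro!: image_eqI[of _ _ "c (x + per c - 1)"])
    qed
    ultimately have "card E \<le> card (head G ` E) + b"
      using card_arcs_le_verts_plus_betti1[OF E, of G] b by simp
    then have "card (merging G E) \<le> 2 * b"
      using card_noninjective_part[OF E, of "head G" b] by (simp add: merging_def)
    then obtain c e where c: "c \<in> F'" "e \<in> range c" "\<forall>d\<in>F'. e \<in> range d \<longrightarrow> d = c"
    proof -
      have "\<exists>c\<in>F'. \<exists>e\<in>range c. \<forall>d\<in>F'. e \<in> range d \<longrightarrow> d = c"
      proof (rule exists_private_arc[OF \<open>finite F'\<close> F'(2)])
        show "card (merging G (\<Union>c\<in>F'. range c)) \<le> 2 * b"
          using \<open>card (merging G E) \<le> 2 * b\<close> by (simp add: E_def)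
      qed (use F' F(2) ineq long in \<open>simp_all add: subset_iff\<close>)
      then show ?thesis using that by blast
    qed
    have "loop_chain c e \<noteq> 0"
      using c(1,2) F'(1) per by (intro iffD2[OF loop_chain_nonzero_iff]) auto
    moreover have "loop_chain d e = 0" if "d \<in> F' - {c}" for d
    proof -
      have "e \<notin> range d" using that c(3) by blast
      moreover have "periodic d" using that F'(1) per by auto
      ultimately show ?thesis using loop_chain_nonzero_iff[of d e] by simp
    qed
    ultimately show ?thesis using c(1) by blast
  qed
  then have "chain.independent (loop_chain ` F) \<and> card (loop_chain ` F) = card F"
    by (intro independent_of_private F)
  moreover have "loop_chain ` F \<subseteq> H1 G" using F(2) loop_chain_in_H1 by blast
  ultimately show ?thesis using betti1_ge_card[of "loop_chain ` F" G] F(1) b by simp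
qed

end

subsection \<open>Cycles and circles\<close>

text \<open>Only the edges are kept, since the vertices are their tails.\<close>

definition unroll :: "nat \<Rightarrow> (nat, nat, 'v, 'e) gmap \<Rightarrow> nat \<Rightarrow> 'e" where
  "unroll k f x = snd f (x mod k)"

lemma graph_map_circle_iff:
  assumes "k \<ge> 1"
  shows "graph_map (circle k) G f \<longleftrightarrow> (\<forall>x<k. fst f x \<in> verts G) \<and>
    (\<forall>x<k. snd f x \<in> arcs G \<and> tail G (snd f x) = fst f x \<and> head G (snd f x) = fst f (Suc x mod k))"
  by (auto simp: graph_map_def circle_def)

lemma cycle_unroll:
  assumes "cycle G k f"
  shows "k \<ge> 1" "loop G (unroll k f)" "is_period (unroll k f) k"
    "x < k \<Longrightarrow> fst f x = tail G (unroll k f x)"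
proof -
  show k: "k \<ge> 1" using assms by (simp add: cycle_def)
  then have f: "snd f x \<in> arcs G" "tail G (snd f x) = fst f x" "head G (snd f x) = fst f (Suc x mod k)"
    if "x < k" for x
    using assms that by (auto simp: cycle_def graph_map_circle_iff)
  show period: "is_period (unroll k f) k" by (simp add: is_period_def unroll_def)
  have "head G (unroll k f x) = tail G (unroll k f (Suc x))" for x
    using f[of "x mod k"] f[of "Suc x mod k"] k by (simp add: unroll_def mod_Suc_eq)
  then show "loop G (unroll k f)"
    using f k period unfolding loop_def periodic_def by (auto simp: unroll_def)
  show "x < k \<Longrightarrow> fst f x = tail G (unroll k f x)" using f by (simp add: unroll_def)
qed

lemma in_arcs_circle:
  assumes "v < k"
  shows "in_arcs (circle k) v = {(v + k - 1) mod k}"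
proof (intro equalityI subsetI)
  fix e assume "e \<in> in_arcs (circle k) v"
  then have e: "e < k" "Suc e mod k = v" by (auto simp: circle_def)
  show "e \<in> {(v + k - 1) mod k}"
  proof (cases "Suc e < k")
    case False
    then have "Suc e = k" using e(1) by simp
    then show ?thesis using e by auto
  qed (use e in auto)
next
  fix e assume "e \<in> {(v + k - 1) mod k}"
  moreover have "Suc ((v + k - 1) mod k) mod k = v"
    using assms by (simp add: mod_Suc_eq)
  ultimately show "e \<in> in_arcs (circle k) v" using assms by (auto simp: circle_def)
qed

lemma out_arcs_circle: "v < k \<Longrightarrow> out_arcs (circle k) v = {v}"
  by (auto simp: circle_def)

text \<open>Exactly one edge leaves each vertex of a circle, so the map is determined by the image
  of 0. Counting the fibres gives the degree.\<close>

lemma circle_covering_rotation: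
  assumes k: "k \<ge> 1" and m: "m \<ge> 1" and p: "covering_map_of_degree (circle k) (circle m) p d"
  shows "k = m * d" "x < k \<Longrightarrow> snd p x = (snd p 0 + x) mod m"
proof -
  have gm: "graph_map (circle k) (circle m) p" using p by (simp add: covering_map_of_degree_def)
  have step: "snd p x < m" "snd p x = fst p x" "Suc (snd p x) mod m = fst p (Suc x mod k)" if "x < k" for x
  proof -
    have "x \<in> arcs (circle k)" using that by (simp add: circle_def)
    then have "snd p x \<in> arcs (circle m)" "tail (circle m) (snd p x) = fst p (tail (circle k) x)"
      "head (circle m) (snd p x) = fst p (head (circle k) x)"
      using gm unfolding graph_map_def by blast+
    then show "snd p x < m" "snd p x = fst p x" "Suc (snd p x) mod m = fst p (Suc x mod k)"
      by (simp_all add: circle_def)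
  qed
  have fibres: "fst p ` {..<k} = {..<m}" "\<And>w. w < m \<Longrightarrow> card {x \<in> {..<k}. fst p x = w} = d"
    using p by (auto simp: covering_map_of_degree_def circle_def)
  have "k = (\<Sum>x<k. 1)" by simp
  also have "\<dots> = (\<Sum>w<m. card {x \<in> {..<k}. fst p x = w})"
    using sum.image_gen[of "{..<k}" "\<lambda>_. 1::nat" "fst p"] by (simp add: fibres(1))
  also have "\<dots> = (\<Sum>w<m. d)" by (intro sum.cong refl fibres(2)) simp
  also have "\<dots> = m * d" by simp
  finally show "k = m * d" .
  show "snd p x = (snd p 0 + x) mod m" if "x < k"
    using that
  proof (induction x)
    case 0
    then show ?case using step(1)[of 0] by simp
  next
    case (Suc x)
    have "snd p (Suc x) = Suc (snd p x) mod m" using step[of x] step[of "Suc x"] Suc.prems by simp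
    then show ?case using Suc by (simp add: mod_Suc_eq)
  qed
qed

text \<open>A covering onto a circle of length \<open>m\<close> through which \<open>f\<close>
  factors makes \<open>m\<close> a period of the unrolled sequence. Thus the degree
  \<open>k / m\<close> is largest for the least period, and reduction modulo this period realizes
  it.\<close>

lemma cycle_degree_eq:
  assumes f: "cycle G k f"
  shows "cycle_degree G k f = k div per (unroll k f)"
proof -
  define c where "c = unroll k f"
  note cyc = cycle_unroll[OF f, folded c_def]
  have c: "periodic c" using cyc(1,3) by (auto simp: periodic_def)
  define P where "P = per c"
  have P: "P \<ge> 1" "is_period c P" "P dvd k"
    unfolding P_def using per_ge_1[OF c] per_period[OF c] per_dvd[OF cyc(3,1)] by auto
  let ?D = "{d. \<exists>m p g. m \<ge> 1 \<and> covering_map_of_degree (circle k) (circle m) p d \<and>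
                     graph_map (circle m) G g \<and> gmap_eq (circle k) f (g \<circ>\<^sub>g p)}"
  have le: "d \<le> k div P" if "d \<in> ?D" for d
  proof -
    from that obtain m p g where m: "m \<ge> 1" "covering_map_of_degree (circle k) (circle m) p d"
      "gmap_eq (circle k) f (g \<circ>\<^sub>g p)" by blast
    note p = circle_covering_rotation[OF cyc(1) m(1,2)]
    have "c x = snd g ((snd p 0 + x) mod m)" for x
    proof -
      have "x mod k < k" using cyc(1) by simp
      then have "c x = snd g ((snd p 0 + x mod k) mod m)"
        using m(3) p(2)[of "x mod k"] by (simp add: c_def unroll_def gmap_eq_def gmap_comp_def circle_def)
      moreover have "m dvd k" using p(1) by simp
      ultimately show ?thesis by (metis mod_add_right_eq mod_mod_cancel)
    qed
    then have "is_period c m" by (simp add: is_period_def add.assoc[symmetric])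
    then have "P dvd m" unfolding P_def by (intro per_dvd m)
    then have "k div m \<le> k div P" using m(1) P(1) by (intro div_le_mono2 dvd_imp_le) auto
    then show ?thesis using p(1) m(1) by simp
  qed
  have mem: "k div P \<in> ?D"
  proof -
    define p :: "nat \<Rightarrow> nat" where "p x = x mod P" for x
    have f': "snd f x = c x" "fst f x = tail G (c x)" if "x < k" for x
      using cyc(4) that by (simp_all add: c_def unroll_def)
    have Pk: "x < k" if "x < P" for x using that P cyc(1) dvd_imp_le[of P k] by simp
    have cP: "c (x mod P) = c x" for x by (rule is_period_mod[OF P(2)])
    have arcs: "c x \<in> arcs G" "tail G (c x) \<in> verts G" "head G (c x) = tail G (c (Suc x))" for x
    proof -
      show "c x \<in> arcs G" "head G (c x) = tail G (c (Suc x))" using cyc(2) by (auto simp: loop_def)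
      have "x mod k < k" using cyc(1) by simp
      moreover from this have "fst f (x mod k) \<in> verts G"
        using f cyc(1) by (simp add: cycle_def graph_map_circle_iff)
      ultimately show "tail G (c x) \<in> verts G" using f'(2)[of "x mod k"] is_period_mod[OF cyc(3)] by simp
    qed
    have sucP: "Suc x mod P < P" for x using P(1) by simp
    \<comment> \<open>The map \<open>f\<close> itself serves on the smaller circle: its first
      \<open>P\<close> edges close up because the sequence repeats after \<open>P\<close>
      steps.\<close>
    have "graph_map (circle P) G f"
      using P(1) by (simp add: graph_map_circle_iff f' Pk arcs sucP cP)
    moreover have "gmap_eq (circle k) f (f \<circ>\<^sub>g (p, p))"
    proof -
      have "x mod P < k" for x using P(1) by (intro Pk) simp
      then show ?thesis
        by (simp add: gmap_eq_def gmap_comp_def circle_def p_def f' cP)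
    qed
    moreover have "covering_map_of_degree (circle k) (circle P) (p, p) (k div P)"
      unfolding covering_map_of_degree_def
    proof (intro conjI ballI)
      show "graph_map (circle k) (circle P) (p, p)"
        using P cyc(1) by (simp add: graph_map_circle_iff)
          (simp add: circle_def p_def mod_Suc_eq mod_mod_cancel)
      show "fst (p, p) ` verts (circle k) = verts (circle P)"
      proof (intro equalityI subsetI)
        fix y assume "y \<in> verts (circle P)"
        then show "y \<in> fst (p, p) ` verts (circle k)"
          using Pk by (intro image_eqI[of _ _ y]) (auto simp: circle_def p_def)
      qed (use P(1) in \<open>auto simp: circle_def p_def\<close>)
    next
      fix v assume "v \<in> verts (circle k)"
      then have v: "v < k" "p v < P" using P(1) by (auto simp: circle_def p_def)
      show "bij_betw (snd (p, p)) (out_arcs (circle k) v) (out_arcs (circle P) (fst (p, p) v))"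
        using v by (simp add: out_arcs_circle bij_betw_def)
      obtain q where q: "k = P * q" using P(3) by blast
      then have "q \<ge> 1" using cyc(1) by (cases q) auto
      then obtain q' where q': "k = P + P * q'" using q by (cases q) auto
      \<comment> \<open>Since \<open>P\<close> divides \<open>k\<close>, the predecessor on the
        large circle reduces to the predecessor on the small one.\<close>
      have "(v + k - 1) mod P = (v mod P + P - 1) mod P"
      proof -
        have "v + k - 1 = (v + (P - 1)) + P * q'" "v mod P + P - 1 = v mod P + (P - 1)"
          using q' P(1) by auto
        then show ?thesis by (metis mod_add_left_eq mod_mult_self2)
      qed
      then have "p ((v + k - 1) mod k) = (p v + P - 1) mod P"
        by (simp add: p_def mod_mod_cancel[OF P(3)])
      then show "bij_betw (snd (p, p)) (in_arcs (circle k) v) (in_arcs (circle P) (fst (p, p) v))"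
        using v by (simp add: in_arcs_circle bij_betw_def)
    next
      fix w assume "w \<in> verts (circle P)"
      then have w: "w < P" by (simp add: circle_def)
      have "{v \<in> {..<k}. v mod P = w} = (\<lambda>j. j * P + w) ` {..<k div P}"
      proof (intro equalityI subsetI)
        fix v assume "v \<in> {v \<in> {..<k}. v mod P = w}"
        then have v: "v < k" "v mod P = w" by auto
        then have "v div P < k div P"
          using P(3) by (intro less_mult_imp_div_less) simp
        then show "v \<in> (\<lambda>j. j * P + w) ` {..<k div P}"
          using v(2) by (intro image_eqI[of _ _ "v div P"]) auto
      next
        fix v assume "v \<in> (\<lambda>j. j * P + w) ` {..<k div P}"
        then obtain j where j: "j < k div P" "v = j * P + w" by auto
        have "v < Suc j * P" using j w by simp
        also have "\<dots> \<le> (k div P) * P" using j by (intro mult_le_mono1) simp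
        also have "\<dots> = k" using P(3) by simp
        finally show "v \<in> {v \<in> {..<k}. v mod P = w}" using j w by simp
      qed
      moreover have "inj_on (\<lambda>j. j * P + w) {..<k div P}" using P(1) by (auto simp: inj_on_def)
      ultimately have "card {v \<in> {..<k}. v mod P = w} = k div P" by (simp add: card_image)
      then show "card {v \<in> verts (circle k). fst (p, p) v = w} = k div P"
        by (simp add: circle_def p_def)
    qed
    ultimately show ?thesis using P(1) by blast
  qed
  have "?D \<subseteq> {..k div P}" using le by blast
  then have "finite ?D" using finite_subset by blast
  then show ?thesis
    unfolding cycle_degree_def P_def[symmetric] c_def[symmetric] using le mem by (intro Max_eqI)
qed

section \<open>Maps into disjoint unions of circles\<close>

lemma graph_map_circlesD:
  assumes "graph_map (circles I l) G s" "i \<in> I" "x < l i"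
  shows "snd s (i, x) \<in> arcs G" "tail G (snd s (i, x)) = fst s (i, x)"
    "head G (snd s (i, x)) = fst s (i, Suc x mod l i)"
  using assms by (auto simp: graph_map_def circles_def circle_def)

text \<open>A graph map from a circle to a disjoint union of circles stays on one component and
  advances by one edge at each step. It is therefore a rotation followed by reduction modulo
  \<open>l i\<close>.\<close>

lemma factors_through_circles_iff:
  assumes f: "cycle G k f" and s: "graph_map (circles I l) G s" and l: "\<And>i. i \<in> I \<Longrightarrow> l i \<ge> 1"
  shows "factors_through k f (circles I l) s \<longleftrightarrow>
    (\<exists>i\<in>I. \<exists>j. l i dvd k \<and> (\<forall>x. unroll k f x = snd s (i, (x + j) mod l i)))"
    (is "?L \<longleftrightarrow> ?R")
proof
  have k: "k \<ge> 1" using cycle_unroll(1)[OF f] .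
  {
    assume ?L
    then obtain h where h: "graph_map (circle k) (circles I l) h" "gmap_eq (circle k) f (s \<circ>\<^sub>g h)"
      by (auto simp: factors_through_def)
    have step: "fst (snd h x) \<in> I" "snd (snd h x) < l (fst (snd h x))" "fst h x = snd h x"
      "fst h (Suc x mod k) = (fst (snd h x), Suc (snd (snd h x)) mod l (fst (snd h x)))"
      if "x < k" for x
    proof -
      have "snd h x \<in> arcs (circles I l)" "tail (circles I l) (snd h x) = fst h x"
        "head (circles I l) (snd h x) = fst h (Suc x mod k)"
        using h(1) that by (auto simp: graph_map_circle_iff[OF k])
      then show "fst (snd h x) \<in> I" "snd (snd h x) < l (fst (snd h x))" "fst h x = snd h x"
        "fst h (Suc x mod k) = (fst (snd h x), Suc (snd (snd h x)) mod l (fst (snd h x)))"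
        by (auto simp: circles_def circle_def split: prod.splits)
    qed
    obtain i a where ia: "snd h 0 = (i, a)" by fastforce
    have i: "i \<in> I" "a < l i" using step[of 0] k ia by auto
    have hx: "snd h x = (i, (a + x) mod l i)" if "x < k" for x
      using that
    proof (induction x)
      case 0
      then show ?case using ia i by simp
    next
      case (Suc x)
      then have "snd h (Suc x) = (i, Suc ((a + x) mod l i) mod l i)"
        using step(3)[of "Suc x"] step(4)[of x] by simp
      then show ?case by (simp add: mod_Suc_eq)
    qed
    \<comment> \<open>Comparing the last edge with the first shows that \<open>h\<close> closes up
      only if \<open>l i\<close> divides \<open>k\<close>.\<close>
    obtain k' where k': "k = Suc k'" using k by (cases k) auto
    have "snd h 0 = (i, Suc ((a + k') mod l i) mod l i)"
      using step(3)[of 0] step(4)[of k'] hx[of k'] by (simp add: k')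
    then have "(a + k) mod l i = (a + 0) mod l i"
      using ia i by (simp add: k' mod_Suc_eq)
    then have "k mod l i = 0 mod l i" by (rule mod_add_lcancel_nat)
    then have dvd: "l i dvd k" by auto
    have "unroll k f x = snd s (i, (x + a) mod l i)" for x
    proof -
      have "x mod k < k" using k by simp
      then have "unroll k f x = snd s (i, (a + x mod k) mod l i)"
        using h(2) hx by (simp add: unroll_def gmap_eq_def gmap_comp_def circle_def)
      then show ?thesis by (metis add.commute dvd mod_add_right_eq mod_mod_cancel)
    qed
    then show ?R using i(1) dvd by blast
  next
    assume ?R
    then obtain i j where i: "i \<in> I" "l i dvd k" "\<And>x. unroll k f x = snd s (i, (x + j) mod l i)" by blast
    have lt: "x mod l i < l i" for x using l[OF i(1)] by simp
    define g where "g x = (i, (x + j) mod l i)" for x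
    have "Suc ((x + j) mod l i) mod l i = (Suc x mod k + j) mod l i" for x
    proof -
      have "(Suc x mod k + j) mod l i = (Suc x mod k mod l i + j) mod l i" by (rule mod_add_left_eq[symmetric])
      also have "\<dots> = Suc (x + j) mod l i" by (simp add: mod_mod_cancel[OF i(2)] mod_add_left_eq)
      finally show ?thesis by (simp add: mod_Suc_eq)
    qed
    then have "graph_map (circle k) (circles I l) (g, g)"
      using i(1) lt by (simp add: graph_map_circle_iff[OF k]) (simp add: circles_def circle_def g_def)
    moreover have "gmap_eq (circle k) f (s \<circ>\<^sub>g (g, g))"
    proof -
      have "snd f x = snd s (g x)" "fst f x = fst s (g x)" if "x < k" for x
      proof -
        show *: "snd f x = snd s (g x)" using i(3)[of x] that by (simp add: unroll_def g_def)
        have "fst f x = tail G (snd s (g x))"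
          using cycle_unroll(4)[OF f that] * that by (simp add: unroll_def)
        then show "fst f x = fst s (g x)"
          using graph_map_circlesD(2)[OF s i(1) lt] by (simp add: g_def)
      qed
      then show ?thesis by (simp add: gmap_eq_def gmap_comp_def circle_def)
    qed
    ultimately show ?L unfolding factors_through_def by blast
  }
qed

section \<open>Long cycles as periodic sequences\<close>

definition long_loop :: "('v, 'e) pre_digraph \<Rightarrow> ('e \<Rightarrow> 'f) \<Rightarrow> (nat \<Rightarrow> 'e) \<Rightarrow> bool" where
  "long_loop G lab c \<longleftrightarrow> loop G c \<and>
     ereal (real (per c) / real (per (lab \<circ> c))) \<ge> 12 * ereal_of_enat (betti1 G)"

text \<open>Both degrees are \<open>k\<close> divided by a least period, so \<open>k\<close> cancels
  and the ratio depends only on the unrolled sequence.\<close>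

lemma cycle_degree_ratio:
  assumes f: "cycle G k f" and \<gamma>: "graph_map G H \<gamma>"
  shows "real (cycle_degree H k (\<gamma> \<circ>\<^sub>g f)) / real (cycle_degree G k f) =
    real (per (unroll k f)) / real (per (snd \<gamma> \<circ> unroll k f))"
proof -
  note c = cycle_unroll[OF f]
  have \<gamma>f: "cycle H k (\<gamma> \<circ>\<^sub>g f)"
    using f \<gamma> by (auto simp: cycle_def graph_map_circle_iff) (auto simp: graph_map_def gmap_comp_def)
  have deg: "cycle_degree H k (\<gamma> \<circ>\<^sub>g f) = k div per (snd \<gamma> \<circ> unroll k f)"
    using cycle_degree_eq[OF \<gamma>f] by (simp add: unroll_def[abs_def] gmap_comp_def comp_def)
  have dvd: "per (unroll k f) dvd k" "per (snd \<gamma> \<circ> unroll k f) dvd k"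
    by (rule per_dvd[OF c(3,1)], rule per_dvd[OF is_period_comp[OF c(3)] c(1)])
  then have "real (k div per (unroll k f)) = real k / real (per (unroll k f))"
    "real (k div per (snd \<gamma> \<circ> unroll k f)) = real k / real (per (snd \<gamma> \<circ> unroll k f))"
    by (simp_all add: real_of_nat_div)
  then show ?thesis
    using c(1) by (simp add: deg cycle_degree_eq[OF f])
qed

text \<open>A cycle and the primitive cycle that it winds around unroll to the same sequence, so it
  suffices to test primitive ones. For these, factoring forces the circle to have exactly the length
  \<open>per c\<close>.\<close>

lemma captures_long_cycles_iff:
  assumes G: "wf_digraph G" and \<gamma>: "graph_map G H \<gamma>"
  shows "captures_long_cycles G H \<gamma> I l s \<longleftrightarrow>
     (\<forall>i \<in> I. l i \<ge> 1) \<and> (if finite I then enat (card I) else \<infinity>) \<le> betti1 G \<and>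
     graph_map (circles I l) G s \<and>
     (\<forall>c. long_loop G (snd \<gamma>) c \<longrightarrow>
        (\<exists>i\<in>I. \<exists>j. l i = per c \<and> (\<forall>x. c x = snd s (i, (x + j) mod l i))))"
    (is "_ \<longleftrightarrow> ?l \<and> ?card \<and> ?s \<and> ?R")
proof -
  have "(\<forall>k f. cycle G k f \<longrightarrow>
        ereal (real (cycle_degree H k (\<gamma> \<circ>\<^sub>g f)) / real (cycle_degree G k f))
          \<ge> 12 * ereal_of_enat (betti1 G) \<longrightarrow>
        factors_through k f (circles I l) s) \<longleftrightarrow> ?R" (is "?C \<longleftrightarrow> ?R") if l: ?l and s: ?s
  proof
    assume C: ?C
    show ?R
    proof (intro allI impI)
      fix c assume c: "long_loop G (snd \<gamma>) c"
      define k where "k = per c"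
      have loop: "loop G c" "periodic c" using c by (auto simp: long_loop_def loop_def)
      have k: "k \<ge> 1" "is_period c k"
        unfolding k_def using loop(2) per_ge_1 per_period by blast+
      define f where "f = ((\<lambda>x. tail G (c x)), c)"
      have un: "unroll k f = c"
        by (intro ext) (simp add: unroll_def f_def is_period_mod[OF k(2)])
      have arc: "c x \<in> arcs G" "head G (c x) = tail G (c (Suc x mod k))" for x
        using loop(1) is_period_mod[OF k(2), of "Suc x"] by (auto simp: loop_def)
      have cyc: "cycle G k f"
        using k(1) arc wf_digraph.tail_in_verts[OF G] by (simp add: cycle_def graph_map_circle_iff f_def)
      then have "factors_through k f (circles I l) s"
        using c cycle_degree_ratio[OF cyc \<gamma>]
        by (intro C[rule_format, OF cyc]) (simp add: long_loop_def un)
      then obtain i j where i: "i \<in> I" "l i dvd k" "\<And>x. c x = snd s (i, (x + j) mod l i)"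
        using factors_through_circles_iff[OF cyc s] l un by auto
      have "is_period c (l i)"
        unfolding is_period_def
      proof
        fix x
        have "(x + l i + j) mod l i = (x + j) mod l i"
          by (metis add.commute add.left_commute mod_add_self2)
        then show "c (x + l i) = c x" by (simp only: i(3))
      qed
      then have "k dvd l i" unfolding k_def using l i(1) by (intro per_dvd) auto
      then have "l i = per c" using i(2) dvd_antisym k_def by blast
      then show "\<exists>i\<in>I. \<exists>j. l i = per c \<and> (\<forall>x. c x = snd s (i, (x + j) mod l i))"
        using i by blast
    qed
  next
    assume R: ?R
    show ?C
    proof (intro allI impI)
      fix k f assume f: "cycle G k f" and long: "ereal (real (cycle_degree H k (\<gamma> \<circ>\<^sub>g f)) /
        real (cycle_degree G k f)) \<ge> 12 * ereal_of_enat (betti1 G)"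
      note c = cycle_unroll[OF f]
      have "long_loop G (snd \<gamma>) (unroll k f)"
        using long c(2) cycle_degree_ratio[OF f \<gamma>] by (simp add: long_loop_def)
      then obtain i j where "i \<in> I" "l i = per (unroll k f)"
        "\<forall>x. unroll k f x = snd s (i, (x + j) mod l i)" using R by blast
      moreover have "per (unroll k f) dvd k" by (rule per_dvd[OF c(3,1)])
      ultimately show "factors_through k f (circles I l) s"
        using factors_through_circles_iff[OF f s] l by metis
    qed
  qed
  then show ?thesis unfolding captures_long_cycles_def by blast
qed

lemma exists_rot_equiv_transversal:
  assumes "\<And>c. c \<in> L \<Longrightarrow> periodic c"
  obtains R where "R \<subseteq> L" "\<And>c. c \<in> L \<Longrightarrow> \<exists>d\<in>R. rot_equiv c d"
    "\<And>c d. c \<in> R \<Longrightarrow> d \<in> R \<Longrightarrow> rot_equiv c d \<Longrightarrow> c = d"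
proof -
  \<comment> \<open>The choice depends only on a predicate, and equivalent sequences define the same
    predicate, so \<open>r\<close> is constant on classes.\<close>
  define r where "r c = (SOME d. d \<in> L \<and> rot_equiv c d)" for c
  have r: "r c \<in> L \<and> rot_equiv c (r c)" if "c \<in> L" for c
    unfolding r_def by (rule someI[of _ c]) (simp add: that rot_equiv_refl)
  have eq: "r c = r d" if cd: "c \<in> L" "d \<in> L" "rot_equiv c d" for c d
  proof -
    have "rot_equiv c e \<longleftrightarrow> rot_equiv d e" for e
      using cd assms rot_equiv_sym rot_equiv_trans by metis
    then show ?thesis by (simp add: r_def)
  qed
  show ?thesis
  proof (rule that[of "r ` L"])
    show "r ` L \<subseteq> L" using r by blast
    show "\<exists>d\<in>r ` L. rot_equiv c d" if "c \<in> L" for c using r that by blast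
  next
    fix c' d' assume "c' \<in> r ` L" "d' \<in> r ` L" and equiv: "rot_equiv c' d'"
    then obtain c d where cd: "c \<in> L" "c' = r c" "d \<in> L" "d' = r d" by blast
    then have "c' \<in> L" "d' \<in> L" using r by auto
    then have "r c' = r d'" using eq equiv by blast
    moreover have "r c' = c'" "r d' = d'"
      using eq[of c c'] eq[of d d'] r[of c] r[of d] cd by auto
    ultimately show "c' = d'" by simp
  qed
qed

text \<open>If the Betti number is infinite, so is the threshold, and there are no long loops.
  Otherwise all finite sets of representatives obey the same bound, which also makes
  \<open>R\<close> finite.\<close>

lemma exists_long_loop_representatives:
  assumes G: "wf_digraph G" and \<gamma>: "forwards_immersion G H \<gamma>"
  obtains R where "\<forall>c\<in>R. long_loop G (snd \<gamma>) c"
    "\<forall>c. long_loop G (snd \<gamma>) c \<longrightarrow> (\<exists>d\<in>R. rot_equiv c d)"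
    "\<forall>c\<in>R. \<forall>d\<in>R. rot_equiv c d \<longrightarrow> c = d"
    "finite R" "enat (card R) \<le> betti1 G"
proof -
  interpret deterministic_digraph G "snd \<gamma>"
    using G \<gamma> by (simp add: deterministic_digraph_def deterministic_digraph_axioms_def forwards_immersion_def)
  define L where "L = Collect (long_loop G (snd \<gamma>))"
  have "periodic c" if "c \<in> L" for c using that by (auto simp: L_def long_loop_def loop_def)
  then obtain R where R: "R \<subseteq> L" "\<And>c. c \<in> L \<Longrightarrow> \<exists>d\<in>R. rot_equiv c d"
    "\<And>c d. c \<in> R \<Longrightarrow> d \<in> R \<Longrightarrow> rot_equiv c d \<Longrightarrow> c = d"
    using exists_rot_equiv_transversal by blast
  have "finite R \<and> enat (card R) \<le> betti1 G"
  proof (cases "betti1 G")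
    case infinity
    then have "L = {}" by (auto simp: L_def long_loop_def)
    then show ?thesis using R(1) infinity by auto
  next
    case (enat b)
    have "card F \<le> b" if F: "F \<subseteq> R" "finite F" for F
    proof (rule card_inequivalent_long_loops_le[OF enat F(2)])
      fix c assume "c \<in> F"
      then have c: "loop G c" "12 * real b \<le> real (per c) / real (per (snd \<gamma> \<circ> c))"
        using F(1) R(1) by (auto simp: L_def long_loop_def enat)
      show "loop G c" by (rule c)
      have "periodic (snd \<gamma> \<circ> c)" using c(1) by (simp add: loop_def periodic_comp)
      then have "per (snd \<gamma> \<circ> c) \<ge> 1" by (rule per_ge_1)
      then have "real (12 * b * per (snd \<gamma> \<circ> c)) \<le> real (per c)"
        using c(2) by (simp add: field_simps)
      then show "12 * b * per (snd \<gamma> \<circ> c) \<le> per c" by (simp only: of_nat_le_iff)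
    qed (use F R(3) in blast)
    then have "finite R \<and> card R \<le> b" by (rule finite_if_finite_subsets_card_bdd)
    then show ?thesis using enat by simp
  qed
  then show ?thesis using that[of R] R by (auto simp: L_def)
qed

lemma bij_betw_rotation:
  assumes "(l::nat) \<ge> 1"
  shows "bij_betw (\<lambda>x. (x + j) mod l) {..<l} {..<l}"
proof -
  have "inj_on (\<lambda>x. (x + j) mod l) {..<l}"
  proof (rule inj_onI)
    fix x y assume xy: "x \<in> {..<l}" "y \<in> {..<l}" "(x + j) mod l = (y + j) mod l"
    then have "x mod l = y mod l" using mod_add_lcancel_nat[of j x l y] by (simp add: add.commute)
    then show "x = y" using xy by simp
  qed
  moreover have "(\<lambda>x. (x + j) mod l) ` {..<l} \<subseteq> {..<l}" using assms by auto
  ultimately show ?thesis using endo_inj_surj[of "{..<l}"] by (auto simp: bij_betw_def)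
qed

text \<open>For existence, take one circle for each class of long primitive cycles. For uniqueness,
  any capturing family contains a rotated copy of each of these circles; the copies alone already
  capture, so minimality leaves nothing else.\<close>

theorem theorem4p19:
  fixes \<Gamma> :: "('v, 'e) pre_digraph" and \<Delta> :: "('w, 'f) pre_digraph"
    and \<gamma> :: "('v, 'e, 'w, 'f) gmap"
  assumes "wf_digraph \<Gamma>" and "wf_digraph \<Delta>" and "forwards_immersion \<Gamma> \<Delta> \<gamma>"
  shows "\<exists>(I :: nat set) l s.
           minimally_captures_long_cycles \<Gamma> \<Delta> \<gamma> I l s \<and>
           (\<forall>(I' :: 'i set) l' s'. minimally_captures_long_cycles \<Gamma> \<Delta> \<gamma> I' l' s' \<longrightarrow>
              (\<exists>h. graph_iso (circles I l) (circles I' l') h \<and>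
                   gmap_eq (circles I l) s (s' \<circ>\<^sub>g h)))"
proof -
  have \<gamma>: "graph_map \<Gamma> \<Delta> \<gamma>" using assms(3) by (simp add: forwards_immersion_def)
  note captures_iff = captures_long_cycles_iff[OF assms(1) \<gamma>]
  let ?long = "long_loop \<Gamma> (snd \<gamma>)"
  from exists_long_loop_representatives[OF assms(1,3)] obtain R where R:
    "\<forall>c\<in>R. ?long c" "\<forall>c. ?long c \<longrightarrow> (\<exists>d\<in>R. rot_equiv c d)"
    "\<forall>c\<in>R. \<forall>d\<in>R. rot_equiv c d \<longrightarrow> c = d"
    "finite R" "enat (card R) \<le> betti1 \<Gamma>" .
  define I where "I = {..<card R}"
  obtain r where r: "bij_betw r I R"
    using ex_bij_betw_nat_finite[OF R(4)] by (auto simp: I_def atLeast0LessThan)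
  define l where "l i = per (r i)" for i
  define s :: "(nat \<times> nat, nat \<times> nat, 'v, 'e) gmap"
    where "s = ((\<lambda>(i, x). tail \<Gamma> (r i x)), (\<lambda>(i, x). r i x))"
  have rR: "r i \<in> R" if "i \<in> I" for i using r that bij_betwE by blast
  have r_inj: "i = j" if "i \<in> I" "j \<in> I" "rot_equiv (r i) (r j)" for i j
    using r R(3) rR that by (auto simp: bij_betw_def inj_on_def)
  have long: "?long (r i)" "loop \<Gamma> (r i)" "periodic (r i)" "is_period (r i) (l i)" "l i \<ge> 1"
    if "i \<in> I" for i
  proof -
    show "?long (r i)" using R(1) rR that by blast
    then show "loop \<Gamma> (r i)" "periodic (r i)" by (auto simp: long_loop_def loop_def)
    then show "is_period (r i) (l i)" "l i \<ge> 1"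
      using per_period[of "r i"] per_ge_1[of "r i"] by (simp_all add: l_def)
  qed
  have r_mod: "r i (x mod l i) = r i x" if "i \<in> I" for i x
    using is_period_mod[OF long(4)[OF that]] .
  have "graph_map (circles I l) \<Gamma> s"
  proof -
    have arc: "r i x \<in> arcs \<Gamma>" "tail \<Gamma> (r i x) \<in> verts \<Gamma>"
      "head \<Gamma> (r i x) = tail \<Gamma> (r i (Suc x mod l i))" if "i \<in> I" for i x
    proof -
      show "r i x \<in> arcs \<Gamma>" using long(2)[OF that] by (simp add: loop_def)
      then show "tail \<Gamma> (r i x) \<in> verts \<Gamma>" by (rule wf_digraph.tail_in_verts[OF assms(1)])
      show "head \<Gamma> (r i x) = tail \<Gamma> (r i (Suc x mod l i))"
        using long(2)[OF that] by (simp add: loop_def r_mod[OF that])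
    qed
    then show ?thesis by (auto simp: graph_map_def circles_def circle_def s_def)
  qed
  moreover have "\<exists>i\<in>I. \<exists>j. l i = per c \<and> (\<forall>x. c x = snd s (i, (x + j) mod l i))" if c: "?long c" for c
  proof -
    obtain d where "d \<in> R" "rot_equiv c d" using R(2) c by blast
    then obtain i where i: "i \<in> I" "rot_equiv c (r i)" using r by (auto simp: bij_betw_def)
    then obtain j where j: "c = (\<lambda>x. r i (x + j))" by (auto simp: rot_equiv_def)
    then have "l i = per c" using long(3)[OF i(1)] by (simp add: l_def per_shift)
    then show ?thesis using i(1) j r_mod by (auto simp: s_def)
  qed
  ultimately have captures: "captures_long_cycles \<Gamma> \<Delta> \<gamma> I l s"
    using R(5) long(5) by (simp add: captures_iff I_def)
  \<comment> \<open>If circle \<open>i\<close> could be omitted, \<open>r i\<close> would be a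
    rotation of another representative.\<close>
  have minimal: "\<not> captures_long_cycles \<Gamma> \<Delta> \<gamma> J l s" if J: "J \<subset> I" for J
  proof
    assume "captures_long_cycles \<Gamma> \<Delta> \<gamma> J l s"
    moreover obtain i where i: "i \<in> I" "i \<notin> J" using J by blast
    ultimately obtain j t where j: "j \<in> J" "\<And>x. r i x = snd s (j, (x + t) mod l j)"
      unfolding captures_iff using long(1) by blast
    then have "r i x = r j (x + t)" for x using J by (auto simp: s_def r_mod)
    then have "rot_equiv (r i) (r j)" by (auto simp: rot_equiv_def)
    then show False using r_inj i j(1) J by blast
  qed
  have unique: "\<exists>h. graph_iso (circles I l) (circles I' l') h \<and> gmap_eq (circles I l) s (s' \<circ>\<^sub>g h)"
    if min': "minimally_captures_long_cycles \<Gamma> \<Delta> \<gamma> I' l' s'" for I' :: "'i set" and l' s'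
  proof -
    have cap': "\<forall>i\<in>I'. l' i \<ge> 1" "(if finite I' then enat (card I') else \<infinity>) \<le> betti1 \<Gamma>"
      "graph_map (circles I' l') \<Gamma> s'"
      "\<And>c. ?long c \<Longrightarrow> \<exists>i\<in>I'. \<exists>j. l' i = per c \<and> (\<forall>x. c x = snd s' (i, (x + j) mod l' i))"
      using min' unfolding minimally_captures_long_cycles_def captures_iff by blast+
    have "\<forall>i\<in>I. \<exists>i'\<in>I'. \<exists>j. l' i' = l i \<and> (\<forall>x. r i x = snd s' (i', (x + j) mod l' i'))"
      using cap'(4) long(1) by (simp add: l_def)
    \<comment> \<open>\<open>\<pi> i\<close> is the circle of the other family that carries
      \<open>r i\<close>, and \<open>t i\<close> is the offset between the two starting
      points.\<close>
    then obtain \<pi> t where \<pi>: "\<And>i. i \<in> I \<Longrightarrow> \<pi> i \<in> I'" "\<And>i. i \<in> I \<Longrightarrow> l' (\<pi> i) = l i"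
      "\<And>i x. i \<in> I \<Longrightarrow> r i x = snd s' (\<pi> i, (x + t i) mod l i)"
      by metis
    have "captures_long_cycles \<Gamma> \<Delta> \<gamma> (\<pi> ` I) l' s'"
      unfolding captures_iff
    proof (intro conjI allI impI)
      show "\<forall>i\<in>\<pi> ` I. 1 \<le> l' i" using cap'(1) \<pi>(1) by blast
      have "card (\<pi> ` I) \<le> card R" using card_image_le[of I \<pi>] by (simp add: I_def)
      then show "(if finite (\<pi> ` I) then enat (card (\<pi> ` I)) else \<infinity>) \<le> betti1 \<Gamma>"
        using order_trans[OF _ R(5), of "enat (card (\<pi> ` I))"] by (simp add: I_def)
      show "graph_map (circles (\<pi> ` I) l') \<Gamma> s'"
        using cap'(3) \<pi>(1) by (fastforce simp: graph_map_def circles_def)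
    next
      fix c assume "?long c"
      then obtain i j where i: "i \<in> I" "l i = per c" "\<And>x. c x = snd s (i, (x + j) mod l i)"
        using captures unfolding captures_iff by blast
      have "c x = snd s' (\<pi> i, (x + (j + t i)) mod l' (\<pi> i))" for x
        using i \<pi>(2,3) by (simp add: s_def r_mod mod_add_left_eq add.assoc)
      then show "\<exists>i\<in>\<pi> ` I. \<exists>j. l' i = per c \<and> (\<forall>x. c x = snd s' (i, (x + j) mod l' i))"
        using i(1,2) \<pi>(2)[OF i(1)] by (intro bexI[of _ "\<pi> i"] exI[of _ "j + t i"]) simp_all
    qed
    moreover have "\<pi> ` I \<subseteq> I'" using \<pi>(1) by blast
    ultimately have \<pi>_img: "\<pi> ` I = I'"
      using min' unfolding minimally_captures_long_cycles_def by blast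
    \<comment> \<open>Two representatives carried by one circle would both be rotations of the
      sequence \<open>\<sigma>\<close> read along it.\<close>
    have \<pi>_inj: "i = j" if ij: "i \<in> I" "j \<in> I" "\<pi> i = \<pi> j" for i j
    proof -
      define \<sigma> where "\<sigma> x = snd s' (\<pi> i, x mod l i)" for x
      have lij: "l j = l i" using \<pi>(2)[OF ij(1)] \<pi>(2)[OF ij(2)] ij(3) by simp
      have "rot_equiv (r i) \<sigma>" "rot_equiv (r j) \<sigma>"
        using \<pi>(3)[OF ij(1)] \<pi>(3)[OF ij(2)] ij(3) by (auto simp: rot_equiv_def \<sigma>_def lij)
      moreover have "is_period \<sigma> (l i)" by (simp add: is_period_def \<sigma>_def)
      then have "periodic \<sigma>" using long(5)[OF ij(1)] by (auto simp: periodic_def)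
      ultimately show ?thesis using r_inj ij rot_equiv_sym rot_equiv_trans by blast
    qed
    define h where "h = (\<lambda>(i, x). (\<pi> i, (x + t i) mod l i))"
    have bij: "bij_betw h (SIGMA i:I. {..<l i}) (SIGMA i:I'. {..<l' i})"
    proof -
      have rot: "bij_betw (\<lambda>x. (x + t i) mod l i) {..<l i} {..<l i}" if "i \<in> I" for i
        using long(5)[OF that] by (rule bij_betw_rotation)
      have "inj_on h (SIGMA i:I. {..<l i})"
      proof (rule inj_onI)
        fix p q assume pq: "p \<in> (SIGMA i:I. {..<l i})" "q \<in> (SIGMA i:I. {..<l i})" "h p = h q"
        obtain i x j y where "p = (i, x)" "q = (j, y)" by fastforce
        then show "p = q"
          using pq \<pi>_inj[of i j] inj_onD[OF bij_betw_imp_inj_on[OF rot[of i]], of x y] by (auto simp: h_def)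
      qed
      moreover have "h ` (SIGMA i:I. {..<l i}) = (SIGMA i:I'. {..<l' i})"
      proof (intro equalityI subsetI)
        fix p assume "p \<in> (SIGMA i:I'. {..<l' i})"
        then obtain i y where i: "i \<in> I" "p = (\<pi> i, y)" "y \<in> {..<l i}" using \<pi>(2) \<pi>_img by auto
        then obtain x where "x \<in> {..<l i}" "y = (x + t i) mod l i"
          using bij_betw_imp_surj_on[OF rot[OF i(1)]] by blast
        then show "p \<in> h ` (SIGMA i:I. {..<l i})" using i by (auto simp: h_def intro!: image_eqI[of _ _ "(i, x)"])
      next
        fix p assume "p \<in> h ` (SIGMA i:I. {..<l i})"
        then show "p \<in> (SIGMA i:I'. {..<l' i})" using \<pi>(1,2) by (auto simp: h_def)
      qed
      ultimately show ?thesis by (simp add: bij_betw_def)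
    qed
    have "graph_iso (circles I l) (circles I' l') (h, h)"
      unfolding graph_iso_def
    proof (intro conjI)
      have "h p \<in> (SIGMA i:I'. {..<l' i})" if "p \<in> (SIGMA i:I. {..<l i})" for p
        using bij that bij_betwE by blast
      moreover have "Suc ((x + t i) mod l i) mod l i = (Suc x mod l i + t i) mod l i" for i x
        by (simp add: mod_Suc_eq mod_add_left_eq)
      ultimately show "graph_map (circles I l) (circles I' l') (h, h)"
        by (auto simp: graph_map_def circles_def circle_def h_def \<pi>(2))
    qed (use bij in \<open>simp_all add: circles_def circle_def\<close>)
    moreover have "gmap_eq (circles I l) s (s' \<circ>\<^sub>g (h, h))"
    proof -
      \<comment> \<open>Equality on edges is the choice of \<open>\<pi>\<close> and
        \<open>t\<close>. It implies equality on vertices, which are the tails of these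
        edges.\<close>
      have "snd s (i, x) = snd s' (h (i, x))" "fst s (i, x) = fst s' (h (i, x))" if i: "i \<in> I" for i x
      proof -
        show eq: "snd s (i, x) = snd s' (h (i, x))" using \<pi>(3)[OF i] by (simp add: s_def h_def)
        have "(x + t i) mod l i < l' (\<pi> i)" using \<pi>(2)[OF i] long(5)[OF i] by simp
        then have "tail \<Gamma> (snd s' (h (i, x))) = fst s' (h (i, x))"
          using graph_map_circlesD(2)[OF cap'(3) \<pi>(1)[OF i]] by (simp add: h_def)
        then show "fst s (i, x) = fst s' (h (i, x))" using eq by (simp add: s_def)
      qed
      then show ?thesis by (auto simp: gmap_eq_def gmap_comp_def circles_def)
    qed
    ultimately show ?thesis by blast
  qed
  have "minimally_captures_long_cycles \<Gamma> \<Delta> \<gamma> I l s"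
    using captures minimal by (simp add: minimally_captures_long_cycles_def)
  then show ?thesis
    by (intro exI[of _ I] exI[of _ l] exI[of _ s] conjI allI impI unique)
qed

end
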